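(* Assume that $\mathrm{Tr}(e^{-tD^2})\stackrel{t\to0}{\sim}f(-\log t)\,t^\alpha$, where $\alpha<0$ and $f:\mathbb R^{\ge0}\to\mathbb R$ is a bounded, locally integrable function for which $\lim_{s\to0^+}s\mathcal L[f](s)$ exists and is non-zero. Let $A\in\mathcal B(\mathfrak H)$ be weakly regular, that is, $\mathrm{Tr}(e^{-tD^2}A)\stackrel{t\to0}{\sim}f_A(-\log t)\,t^\alpha$ with the same $\alpha$ and a bounded, non-zero, locally integrable function $f_A:\mathbb R^{\ge0}\to\mathbb C$ for which $\lim_{s\to0^+}s\mathcal L[f_A](s)$ exists. Then $\lim_{s\to s_0^+}\frac1{\zeta(s)}\mathrm{Tr}(|D|^{-s}A)$ exists and is equal to $$\mathcal T(A)=\lim_{s\to0^+}\frac{\mathcal L[f_A](s)}{\mathcal L[f](s)}.$$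
   Context: $(\mathcal A,\mathfrak H,D)$ is a spectral triple; in particular $D$ is an unbounded self-adjoint operator on the Hilbert space $\mathfrak H$, assumed invertible with compact inverse, and $e^{-tD^2}$ is trace class for all $t>0$. $\zeta(s)=\mathrm{Tr}(|D|^{-s})$, with abscissa of convergence $s_0$ (the metric dimension). $\mathcal L[f](s)=\int_0^\infty f(x)e^{-sx}\,dx$ is the Laplace transform. $g_1\stackrel{t\to0}{\sim}g_2$ means $|g_1-g_2|=o(|g_2|)$ as $t\to0^+$. The spectral state $\mathcal T(A)=\mathrm{Tr}_\omega(|D|^{-s_0}A)/\mathrm{Tr}_\omega(|D|^{-s_0})$ ($\mathrm{Tr}_\omega$ a Dixmier trace) is given by $\mathcal T(A)=\lim_{s\to s_0^+}\mathrm{Tr}(|D|^{-s}A)/\zeta(s)$ whenever this limit exists, and this limit is taken as its definition here. *)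

theory Defs
  imports "HOL-Analysis.Analysis" "HOL-Library.Landau_Symbols"
begin

section \<open>Complex Hilbert spaces\<close>

text \<open>The scalar product is antilinear in the first and linear in the second argument. Its positive
  definiteness and the norm come from the underlying real Hilbert space.\<close>

class chilbert_space = real_inner + complete_space +
  fixes scaleC :: "complex \<Rightarrow> 'a \<Rightarrow> 'a" (infixr "*\<^sub>C" 75)
    and cinner :: "'a \<Rightarrow> 'a \<Rightarrow> complex"
  assumes scaleC_add_right: "c *\<^sub>C (x + y) = c *\<^sub>C x + c *\<^sub>C y"
    and scaleC_add_left: "(c + d) *\<^sub>C x = c *\<^sub>C x + d *\<^sub>C x"
    and scaleC_scaleC: "c *\<^sub>C (d *\<^sub>C x) = (c * d) *\<^sub>C x"
    and scaleC_of_real: "complex_of_real r *\<^sub>C x = r *\<^sub>R x"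
    and cinner_commute: "cinner x y = cnj (cinner y x)"
    and cinner_add_right: "cinner x (y + z) = cinner x y + cinner x z"
    and cinner_scaleC_right: "cinner x (c *\<^sub>C y) = c * cinner x y"
    and inner_eq_Re_cinner: "inner x y = Re (cinner x y)"

definition is_onb :: "'a::chilbert_space set \<Rightarrow> bool" where
  "is_onb E \<longleftrightarrow> (\<forall>x\<in>E. \<forall>y\<in>E. cinner x y = (if x = y then 1 else 0)) \<and>
     closure (module.span (*\<^sub>C) E) = UNIV"

definition orth_proj :: "'a::chilbert_space set \<Rightarrow> 'a \<Rightarrow> 'a" where
  "orth_proj S x = (THE y. y \<in> S \<and> (\<forall>z\<in>S. cinner z (x - y) = 0))"

section \<open>Bounded, compact and trace class operators\<close>

definition bounded_clinear :: "('a::chilbert_space \<Rightarrow> 'a) \<Rightarrow> bool" where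
  "bounded_clinear T \<longleftrightarrow> bounded_linear T \<and> (\<forall>c x. T (c *\<^sub>C x) = c *\<^sub>C T x)"

definition compact_op :: "('a::chilbert_space \<Rightarrow> 'a) \<Rightarrow> bool" where
  "compact_op T \<longleftrightarrow> bounded_clinear T \<and> compact (closure (T ` cball 0 1))"

definition positive_op :: "('a::chilbert_space \<Rightarrow> 'a) \<Rightarrow> bool" where
  "positive_op P \<longleftrightarrow> bounded_clinear P \<and> (\<forall>x. cinner x (P x) \<in> \<real> \<and> 0 \<le> Re (cinner x (P x)))"

text \<open>\<open>P = |T|\<close>, that is, \<open>P\<close> is the positive square root of \<open>T\<^sup>* T\<close>; the last conjunct is the
  equation \<open>P\<^sup>2 = P\<^sup>* P = T\<^sup>* T\<close> in terms of matrix elements.\<close>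

definition is_abs_op :: "('a::chilbert_space \<Rightarrow> 'a) \<Rightarrow> ('a \<Rightarrow> 'a) \<Rightarrow> bool" where
  "is_abs_op T P \<longleftrightarrow> positive_op P \<and> (\<forall>x y. cinner (P x) (P y) = cinner (T x) (T y))"

definition trace_class :: "('a::chilbert_space \<Rightarrow> 'a) \<Rightarrow> bool" where
  "trace_class T \<longleftrightarrow> bounded_clinear T \<and>
     (\<exists>P. is_abs_op T P \<and> (\<exists>E. is_onb E \<and> (\<lambda>e. cinner e (P e)) summable_on E))"

text \<open>The common value of \<open>\<Sum>e\<in>E. \<langle>e, T e\<rangle>\<close> for all orthonormal bases \<open>E\<close>; meaningful for
  trace class \<open>T\<close>.\<close>

definition op_trace :: "('a::chilbert_space \<Rightarrow> 'a) \<Rightarrow> complex" where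
  "op_trace T = (THE t. \<forall>E. is_onb E \<longrightarrow> ((\<lambda>e. cinner e (T e)) has_sum t) E)"

section \<open>Unbounded operators\<close>

text \<open>An unbounded operator is given by its domain \<open>V\<close> and a function \<open>D\<close>, whose values outside \<open>V\<close>
  are irrelevant. In the last conjunct below, the left-hand side says that \<open>y\<close> is in the domain
  of the adjoint and is mapped to \<open>z\<close> by it.\<close>

definition self_adjoint_op :: "'a::chilbert_space set \<Rightarrow> ('a \<Rightarrow> 'a) \<Rightarrow> bool" where
  "self_adjoint_op V D \<longleftrightarrow>
     module.subspace (*\<^sub>C) V \<and> closure V = UNIV \<and>
     (\<forall>x\<in>V. \<forall>y\<in>V. D (x + y) = D x + D y) \<and> (\<forall>c. \<forall>x\<in>V. D (c *\<^sub>C x) = c *\<^sub>C D x) \<and>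
     (\<forall>y z. (\<forall>x\<in>V. cinner (D x) y = cinner x z) \<longleftrightarrow> y \<in> V \<and> z = D y)"

definition has_compact_inverse :: "'a::chilbert_space set \<Rightarrow> ('a \<Rightarrow> 'a) \<Rightarrow> bool" where
  "has_compact_inverse V D \<longleftrightarrow> bij_betw D V UNIV \<and> compact_op (inv_into V D)"

definition eigenspace :: "'a::chilbert_space set \<Rightarrow> ('a \<Rightarrow> 'a) \<Rightarrow> real \<Rightarrow> 'a set" where
  "eigenspace V D l = {x \<in> V. D x = l *\<^sub>R x}"

definition eigenvalues :: "'a::chilbert_space set \<Rightarrow> ('a \<Rightarrow> 'a) \<Rightarrow> real set" where
  "eigenvalues V D = {l. eigenspace V D l \<noteq> {0}}"

text \<open>The functional calculus \<open>g(D)\<close> of a self-adjoint operator with compact resolvent. The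
  spectral measure of such an operator is concentrated on its (real) eigenvalues, the mass at
  \<open>l\<close> being the projection onto the eigenspace, so that \<open>\<integral> g dE\<close> is the sum below. If \<open>g\<close>
  is bounded on the eigenvalues, then the sum converges at every vector; otherwise \<open>infsum\<close> extends \<open>g(D)\<close> by
  \<open>0\<close> outside of its domain, and the result is not a bounded operator.\<close>

definition fun_calc :: "'a::chilbert_space set \<Rightarrow> ('a \<Rightarrow> 'a) \<Rightarrow> (real \<Rightarrow> complex) \<Rightarrow> 'a \<Rightarrow> 'a" where
  "fun_calc V D g x = (\<Sum>\<^sub>\<infinity>l\<in>eigenvalues V D. g l *\<^sub>C orth_proj (eigenspace V D l) x)"

definition heat_op :: "'a::chilbert_space set \<Rightarrow> ('a \<Rightarrow> 'a) \<Rightarrow> real \<Rightarrow> 'a \<Rightarrow> 'a" where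
  "heat_op V D t = fun_calc V D (\<lambda>l. of_real (exp (- t * l\<^sup>2)))"

text \<open>\<open>|D|\<close> to the power \<open>-s\<close>, for invertible \<open>D\<close>.\<close>

definition abs_neg_power :: "'a::chilbert_space set \<Rightarrow> ('a \<Rightarrow> 'a) \<Rightarrow> real \<Rightarrow> 'a \<Rightarrow> 'a" where
  "abs_neg_power V D s = fun_calc V D (\<lambda>l. of_real (\<bar>l\<bar> powr (- s)))"

section \<open>Spectral triples\<close>

text \<open>The algebra is identified with its image in the bounded operators, and no more than a
  \<open>*\<close>-algebra is required of it.\<close>

definition star_algebra_of_ops :: "('a::chilbert_space \<Rightarrow> 'a) set \<Rightarrow> bool" where
  "star_algebra_of_ops \<A> \<longleftrightarrow>
     (\<forall>a\<in>\<A>. bounded_clinear a) \<and> (\<lambda>x. 0) \<in> \<A> \<and>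
     (\<forall>a\<in>\<A>. \<forall>b\<in>\<A>. (\<lambda>x. a x + b x) \<in> \<A> \<and> a \<circ> b \<in> \<A>) \<and>
     (\<forall>c. \<forall>a\<in>\<A>. (\<lambda>x. c *\<^sub>C a x) \<in> \<A>) \<and>
     (\<forall>a\<in>\<A>. \<exists>b\<in>\<A>. \<forall>x y. cinner (b x) y = cinner x (a y))"

definition bounded_commutator ::
  "'a::chilbert_space set \<Rightarrow> ('a \<Rightarrow> 'a) \<Rightarrow> ('a \<Rightarrow> 'a) \<Rightarrow> bool" where
  "bounded_commutator V D a \<longleftrightarrow>
     a ` V \<subseteq> V \<and> (\<exists>C. \<forall>x\<in>V. norm (D (a x) - a (D x)) \<le> C * norm x)"

text \<open>The last conjunct says that the resolvent of \<open>D\<close> is compact at some point, hence at every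
  point, of the resolvent set.\<close>

definition spectral_triple ::
  "('a::chilbert_space \<Rightarrow> 'a) set \<Rightarrow> 'a set \<Rightarrow> ('a \<Rightarrow> 'a) \<Rightarrow> bool" where
  "spectral_triple \<A> V D \<longleftrightarrow>
     star_algebra_of_ops \<A> \<and> self_adjoint_op V D \<and>
     (\<forall>a\<in>\<A>. \<forall>\<epsilon>>0. \<exists>b\<in>\<A>. bounded_commutator V D b \<and> onorm (\<lambda>x. a x - b x) < \<epsilon>) \<and>
     (\<exists>z. has_compact_inverse V (\<lambda>x. D x - z *\<^sub>C x))"

definition spectral_zeta :: "'a::chilbert_space set \<Rightarrow> ('a \<Rightarrow> 'a) \<Rightarrow> real \<Rightarrow> complex" where
  "spectral_zeta V D s = op_trace (abs_neg_power V D s)"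

text \<open>The abscissa of convergence of the zeta function. The set is bounded below by \<open>0\<close> if the
  space has infinite dimension; the value is meaningless if it is empty or unbounded below.\<close>

definition metric_dimension :: "'a::chilbert_space set \<Rightarrow> ('a \<Rightarrow> 'a) \<Rightarrow> real" where
  "metric_dimension V D = Inf {s. trace_class (abs_neg_power V D s)}"

definition spectral_state ::
  "'a::chilbert_space set \<Rightarrow> ('a \<Rightarrow> 'a) \<Rightarrow> ('a \<Rightarrow> 'a) \<Rightarrow> complex" where
  "spectral_state V D A = Lim (at_right (metric_dimension V D))
     (\<lambda>s. op_trace (abs_neg_power V D s \<circ> A) / spectral_zeta V D s)"

section \<open>The Laplace transform\<close>

definition laplace :: "(real \<Rightarrow> 'b::{banach, second_countable_topology}) \<Rightarrow> real \<Rightarrow> 'b" where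
  "laplace f s = (LINT x:{0..}|lebesgue. exp (- s * x) *\<^sub>R f x)"

end

theory Submission
  imports Defs
begin

text \<open>A self-adjoint operator with compact inverse has an orthonormal eigenbasis \<open>E\<close>, with eigenvalues
  \<open>\<lambda>\<^sub>e\<close>, and all traces in question become sums over \<open>E\<close>:
  \<open>Tr (exp (- t D\<^sup>2) A) = \<Sum>\<^sub>e exp (- t \<lambda>\<^sub>e\<^sup>2) \<langle>e, A e\<rangle>\<close> and
  \<open>Tr (|D| powr (- s) A) = \<Sum>\<^sub>e |\<lambda>\<^sub>e| powr (- s) \<langle>e, A e\<rangle>\<close>.
  With \<open>t = exp (- x)\<close>, the Mellin transform relating them reads, for \<open>s = 2 (\<epsilon> - \<alpha>)\<close>,
  \<open>\<Gamma>(\<epsilon> - \<alpha>) Tr (|D| powr (- s) A) = \<integral> exp (- \<epsilon> x) k(x) dx\<close> over the whole real line, where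
  \<open>k(x) = exp (\<alpha> x) Tr (exp (- exp (- x) D\<^sup>2) A)\<close> satisfies \<open>k - f\<^sub>A \<rightarrow> 0\<close> at \<open>\<infinity>\<close> and decays
  superexponentially at \<open>-\<infinity>\<close>. Hence \<open>\<epsilon> \<Gamma>(\<epsilon> - \<alpha>) Tr (|D| powr (- s) A)\<close> and \<open>\<epsilon> \<L>[f\<^sub>A](\<epsilon>)\<close>
  have the same limit as \<open>\<epsilon> \<rightarrow> 0\<close>; the theorem is the quotient of this for \<open>A\<close> by the same for
  \<open>1\<close>. The latter limit being non-zero also forces the metric dimension to be \<open>-2\<alpha>\<close>.\<close>

section \<open>Complex Hilbert spaces\<close>

instance chilbert_space \<subseteq> banach ..

interpretation cvec: vector_space "scaleC :: complex \<Rightarrow> 'a::chilbert_space \<Rightarrow> 'a"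
proof
  show "1 *\<^sub>C x = x" for x :: 'a
    using scaleC_of_real[of 1 x] by simp
qed (simp_all add: scaleC_add_right scaleC_add_left scaleC_scaleC)

lemma cinner_add_left: "cinner (x + y) z = cinner x z + cinner y z"
  by (metis cinner_commute cinner_add_right complex_cnj_add)

lemma cinner_scaleC_left: "cinner (c *\<^sub>C x) y = cnj c * cinner x y"
  by (metis cinner_commute cinner_scaleC_right complex_cnj_mult)

lemma cinner_scaleR_right: "cinner x (r *\<^sub>R y) = of_real r * cinner x y"
  by (metis cinner_scaleC_right scaleC_of_real)

lemma cinner_scaleR_left: "cinner (r *\<^sub>R x) y = of_real r * cinner x y"
  by (metis cinner_scaleC_left complex_cnj_complex_of_real scaleC_of_real)

lemma cinner_self: "cinner x x = of_real ((norm x)\<^sup>2)"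
proof (rule complex_eqI)
  show "Im (cinner x x) = Im (of_real ((norm x)\<^sup>2))"
    by (metis Reals_cnj_iff cinner_commute Im_complex_of_real complex_is_Real_iff)
qed (simp add: inner_eq_Re_cinner[symmetric] power2_norm_eq_inner)

lemma norm_scaleC: "norm (c *\<^sub>C x) = cmod c * norm x"
proof -
  have "complex_of_real ((norm (c *\<^sub>C x))\<^sup>2) = of_real ((cmod c * norm x)\<^sup>2)"
    unfolding cinner_self[symmetric] cinner_scaleC_left cinner_scaleC_right
    by (simp add: cinner_self power_mult_distrib complex_norm_square[symmetric] mult.assoc[symmetric]
        mult.commute[of "cnj c"])
  then show ?thesis
    by (metis of_real_eq_iff norm_ge_zero power2_eq_iff_nonneg mult_nonneg_nonneg)
qed

text \<open>Rotating \<open>z\<close> onto the nonnegative axis turns absolute values into values of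
  linear expressions, both for the Cauchy-Schwarz inequality and for the absolute convergence of the
  trace series.\<close>

lemma unimodular_factor:
  obtains u :: complex where "cmod u = 1" "u * z = of_real (cmod z)"
proof (cases "z = 0")
  case False
  show ?thesis
  proof
    show "cmod (cnj z / cmod z) = 1"
      using False by (simp add: norm_divide)
    show "cnj z / cmod z * z = of_real (cmod z)"
      using False by (simp add: complex_norm_square[symmetric] mult.commute[of "cnj z"]
          power2_eq_square field_simps)
  qed
qed (auto intro: that[of 1])

text \<open>The real Cauchy-Schwarz inequality only bounds the real part; a phase on
  \<open>y\<close> first makes the scalar product real and nonnegative.\<close>

lemma norm_cinner_le: "cmod (cinner x y) \<le> norm x * norm y"
proof -
  obtain u where u: "cmod u = 1" "u * cinner x y = of_real (cmod (cinner x y))"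
    by (rule unimodular_factor)
  have "cmod (cinner x y) = inner x (u *\<^sub>C y)"
    by (simp add: inner_eq_Re_cinner cinner_scaleC_right u)
  also have "\<dots> \<le> norm x * norm (u *\<^sub>C y)"
    by (rule norm_cauchy_schwarz)
  finally show ?thesis
    by (simp add: norm_scaleC u)
qed

interpretation cinner: bounded_bilinear "cinner :: 'a::chilbert_space \<Rightarrow> 'a \<Rightarrow> complex"
  by standard (auto simp: cinner_add_left cinner_add_right cinner_scaleR_left cinner_scaleR_right
      scaleR_conv_of_real intro!: exI[of _ 1] norm_cinner_le)

lemma cinner_eq_zero_sym: "cinner x y = 0 \<longleftrightarrow> cinner y x = 0"
  by (metis cinner_commute complex_cnj_zero)

lemma cinner_self_eq_zero: "cinner x x = 0 \<longleftrightarrow> x = 0"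
  by (simp add: cinner_self)

lemma cmod_cinner_commute: "cmod (cinner x y) = cmod (cinner y x)"
  by (metis cinner_commute complex_mod_cnj)

section \<open>Orthogonal series\<close>

lemma norm_sum_orthogonal:
  fixes v :: "'i \<Rightarrow> 'a::real_inner"
  assumes "finite F" "\<And>i j. i \<in> F \<Longrightarrow> j \<in> F \<Longrightarrow> i \<noteq> j \<Longrightarrow> inner (v i) (v j) = 0"
  shows "(norm (\<Sum>i\<in>F. v i))\<^sup>2 = (\<Sum>i\<in>F. (norm (v i))\<^sup>2)"
  using assms
proof (induction F rule: finite_induct)
  case (insert i F)
  have "inner (v i) (\<Sum>j\<in>F. v j) = 0"
    using insert by (subst inner_sum_right) (auto intro!: sum.neutral)
  then have "(norm (v i + (\<Sum>j\<in>F. v j)))\<^sup>2 = (norm (v i))\<^sup>2 + (norm (\<Sum>j\<in>F. v j))\<^sup>2"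
    by (simp add: power2_norm_eq_inner inner_add_left inner_add_right inner_commute)
  then show ?case
    using insert by auto
qed simp

text \<open>By Pythagoras, nested partial sums of \<open>v\<close> differ in squared norm by a
  partial sum of the convergent series of \<open>(norm (v i))\<^sup>2\<close>; hence they are
  Cauchy, and completeness applies.\<close>

lemma summable_on_orthogonal:
  fixes v :: "'i \<Rightarrow> 'a::{real_inner, banach}"
  assumes orth: "\<And>i j. i \<in> I \<Longrightarrow> j \<in> I \<Longrightarrow> i \<noteq> j \<Longrightarrow> inner (v i) (v j) = 0"
    and bound: "\<And>F. finite F \<Longrightarrow> F \<subseteq> I \<Longrightarrow> (\<Sum>i\<in>F. (norm (v i))\<^sup>2) \<le> B"
  shows "v summable_on I"
proof -
  let ?q = "\<lambda>i. (norm (v i))\<^sup>2"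
  have q: "?q summable_on I"
    by (rule nonneg_bdd_above_summable_on) (auto intro!: bdd_aboveI2[of _ _ B] bound)
  have "cauchy_filter (filtermap (sum v) (finite_subsets_at_top I))"
    unfolding cauchy_filter_metric_filtermap
  proof (intro allI impI)
    fix e :: real assume "e > 0"
    \<comment> \<open>As 1/2 is less than the square of 0.8, a tail of squares of at most
      \<open>(e / 2)\<^sup>2 / 2\<close> has norm at most \<open>e / 2 * 0.8\<close>, and two such
      deviations still add up to strictly less than \<open>e\<close>.\<close>
    then have "(e / 2)\<^sup>2 / 2 > 0" by simp
    from infsum_finite_approximation[OF q this] obtain F0 where
      F0: "finite F0" "F0 \<subseteq> I" "dist (sum ?q F0) (infsum ?q I) \<le> (e / 2)\<^sup>2 / 2"
      by blast
    have small: "norm (sum v F - sum v F0) \<le> e / 2 * 0.8"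
      if F: "finite F" "F0 \<subseteq> F" "F \<subseteq> I" for F
    proof -
      have "(norm (sum v F - sum v F0))\<^sup>2 = sum ?q (F - F0)"
        using F orth[OF subsetD[OF F(3)] subsetD[OF F(3)]]
        by (subst sum_diff[symmetric]) (auto intro!: norm_sum_orthogonal)
      also have "\<dots> = sum ?q F - sum ?q F0"
        using F F0 by (simp add: sum_diff)
      also have "\<dots> \<le> infsum ?q I - sum ?q F0"
        using finite_sum_le_infsum[OF q F(1,3)] by simp
      also have "\<dots> \<le> (e / 2)\<^sup>2 / 2"
        using F0(3) unfolding dist_real_def by linarith
      also have "\<dots> \<le> (e / 2 * 0.8)\<^sup>2"
        by (simp add: power2_eq_square)
      finally show ?thesis
        by (rule power2_le_imp_le) (use \<open>e > 0\<close> in simp)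
    qed
    show "\<exists>P. eventually P (finite_subsets_at_top I) \<and>
        (\<forall>x y. P x \<and> P y \<longrightarrow> dist (sum v x) (sum v y) < e)"
    proof (intro exI[of _ "\<lambda>F. finite F \<and> F0 \<subseteq> F \<and> F \<subseteq> I"] conjI allI impI)
      show "\<forall>\<^sub>F F in finite_subsets_at_top I. finite F \<and> F0 \<subseteq> F \<and> F \<subseteq> I"
        using F0 by (auto simp: eventually_finite_subsets_at_top)
      fix F G assume "(finite F \<and> F0 \<subseteq> F \<and> F \<subseteq> I) \<and> finite G \<and> F0 \<subseteq> G \<and> G \<subseteq> I"
      then have "norm (sum v F - sum v F0) \<le> e / 2 * 0.8" "norm (sum v G - sum v F0) \<le> e / 2 * 0.8"
        using small by blast+
      then have "norm ((sum v F - sum v F0) - (sum v G - sum v F0)) \<le> e * 0.8"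
        by (intro order_trans[OF norm_triangle_ineq4]) simp
      then show "dist (sum v F) (sum v G) < e"
        using \<open>e > 0\<close> by (simp add: dist_norm)
    qed
  qed
  moreover have "complete (UNIV :: 'a set)"
    by (rule complete_UNIV)
  ultimately obtain x where "filtermap (sum v) (finite_subsets_at_top I) \<le> nhds x"
    using complete_uniform[of "UNIV :: 'a set"] by (force simp: filtermap_bot_iff)
  then show ?thesis
    by (auto simp: summable_on_def has_sum_def filterlim_def)
qed

text \<open>Expand the squared norm of \<open>x - (\<Sum>i\<in>F. v i)\<close>. The last hypothesis
  makes \<open>v i\<close> the projection of \<open>x\<close> onto its own line; it covers Fourier
  terms as well as projections onto eigenspaces.\<close>

lemma bessel_orthogonal:
  fixes v :: "'i \<Rightarrow> 'a::real_inner"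
  assumes "finite F" "\<And>i j. i \<in> F \<Longrightarrow> j \<in> F \<Longrightarrow> i \<noteq> j \<Longrightarrow> inner (v i) (v j) = 0"
    and "\<And>i. i \<in> F \<Longrightarrow> inner (v i) x = (norm (v i))\<^sup>2"
  shows "(\<Sum>i\<in>F. (norm (v i))\<^sup>2) \<le> (norm x)\<^sup>2"
proof -
  have "inner (\<Sum>i\<in>F. v i) x = (\<Sum>i\<in>F. (norm (v i))\<^sup>2)"
    using assms(3) by (simp add: inner_sum_left)
  moreover have "(norm (x - (\<Sum>i\<in>F. v i)))\<^sup>2 =
      (norm x)\<^sup>2 - 2 * inner (\<Sum>i\<in>F. v i) x + (norm (\<Sum>i\<in>F. v i))\<^sup>2"
    by (simp add: power2_norm_eq_inner inner_diff_left inner_diff_right inner_commute)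
  ultimately show ?thesis
    using norm_sum_orthogonal[OF assms(1,2)] zero_le_power2[of "norm (x - (\<Sum>i\<in>F. v i))"]
    by simp
qed

section \<open>Orthonormal bases\<close>

text \<open>Split off from \<open>is_onb\<close> because subsets of a basis and the members of a
  Zorn chain are orthonormal but possibly not total.\<close>

definition orthonormal :: "'a::chilbert_space set \<Rightarrow> bool" where
  "orthonormal E \<longleftrightarrow> (\<forall>x\<in>E. \<forall>y\<in>E. cinner x y = (if x = y then 1 else 0))"

lemma orthonormalD: "orthonormal E \<Longrightarrow> x \<in> E \<Longrightarrow> y \<in> E \<Longrightarrow> cinner x y = (if x = y then 1 else 0)"
  by (auto simp: orthonormal_def)

lemma orthonormal_norm: "orthonormal E \<Longrightarrow> x \<in> E \<Longrightarrow> norm x = 1"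
proof -
  assume "orthonormal E" "x \<in> E"
  then have "complex_of_real ((norm x)\<^sup>2) = of_real 1"
    unfolding cinner_self[symmetric] by (simp add: orthonormalD)
  then have "(norm x)\<^sup>2 = 1\<^sup>2"
    by (simp only: of_real_eq_iff one_power2)
  then show "norm x = 1"
    by (rule power2_eq_imp_eq) simp_all
qed

lemma is_onb_orthonormal: "is_onb E \<Longrightarrow> orthonormal E"
  by (auto simp: is_onb_def orthonormal_def)

lemma orthonormal_subset: "orthonormal E \<Longrightarrow> F \<subseteq> E \<Longrightarrow> orthonormal F"
  unfolding orthonormal_def by blast

lemma inner_orthonormal_terms:
  assumes "orthonormal E" "e \<in> E" "e' \<in> E" "e \<noteq> e'"
  shows "inner (c *\<^sub>C e) (c' *\<^sub>C e') = 0"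
  using assms by (simp add: inner_eq_Re_cinner cinner_scaleC_left cinner_scaleC_right orthonormalD)

lemma inner_fourier_term:
  assumes "orthonormal E" "e \<in> E"
  shows "inner (cinner e x *\<^sub>C e) x = (norm (cinner e x *\<^sub>C e))\<^sup>2"
  using assms
  by (simp add: inner_eq_Re_cinner cinner_scaleC_left norm_scaleC orthonormal_norm cmod_power2)
     (simp add: power2_eq_square)

lemma norm_sum_orthonormal:
  assumes "orthonormal E" "finite F" "F \<subseteq> E"
  shows "(norm (\<Sum>e\<in>F. c e *\<^sub>C e))\<^sup>2 = (\<Sum>e\<in>F. (cmod (c e))\<^sup>2)"
proof -
  have "(norm (\<Sum>e\<in>F. c e *\<^sub>C e))\<^sup>2 = (\<Sum>e\<in>F. (norm (c e *\<^sub>C e))\<^sup>2)"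
    using assms by (intro norm_sum_orthogonal) (auto intro: inner_orthonormal_terms)
  also have "\<dots> = (\<Sum>e\<in>F. (cmod (c e))\<^sup>2)"
    using assms by (intro sum.cong) (auto simp: norm_scaleC orthonormal_norm subset_iff)
  finally show ?thesis .
qed

lemma bessel:
  assumes "orthonormal E" "finite F" "F \<subseteq> E"
  shows "(\<Sum>e\<in>F. (cmod (cinner e x))\<^sup>2) \<le> (norm x)\<^sup>2"
proof -
  have "(\<Sum>e\<in>F. (norm (cinner e x *\<^sub>C e))\<^sup>2) \<le> (norm x)\<^sup>2"
    using assms by (intro bessel_orthogonal)
      (auto intro: inner_orthonormal_terms inner_fourier_term)
  also have "(\<Sum>e\<in>F. (norm (cinner e x *\<^sub>C e))\<^sup>2) = (\<Sum>e\<in>F. (cmod (cinner e x))\<^sup>2)"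
    using assms by (intro sum.cong) (auto simp: norm_scaleC orthonormal_norm subset_iff)
  finally show ?thesis .
qed

section \<open>Fourier series and totality\<close>

lemma summable_on_fourier:
  assumes "orthonormal E"
  shows "(\<lambda>e. cinner e x *\<^sub>C e) summable_on E"
proof (rule summable_on_orthogonal[of _ _ "(norm x)\<^sup>2"])
  fix F assume F: "finite F" "F \<subseteq> E"
  have "(\<Sum>e\<in>F. (norm (cinner e x *\<^sub>C e))\<^sup>2) = (\<Sum>e\<in>F. (cmod (cinner e x))\<^sup>2)"
    using F assms by (intro sum.cong) (auto simp: norm_scaleC orthonormal_norm subset_iff)
  then show "(\<Sum>e\<in>F. (norm (cinner e x *\<^sub>C e))\<^sup>2) \<le> (norm x)\<^sup>2"
    using bessel[OF assms F] by simp
qed (use assms in \<open>auto intro: inner_orthonormal_terms\<close>)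

lemma has_sum_cinner_right:
  "(v has_sum s) E \<Longrightarrow> ((\<lambda>e. cinner y (v e)) has_sum cinner y s) E"
  by (rule has_sum_bounded_linear[OF cinner.bounded_linear_right])

text \<open>Continuity moves the scalar product inside the sum, where only \<open>e' = e\<close> can
  contribute. For a proper part \<open>F\<close> of \<open>E\<close> these are the coefficients of a
  projection, later the one onto an eigenspace.\<close>

lemma cinner_fourier_sum:
  assumes "orthonormal E" "F \<subseteq> E" "e \<in> E"
  shows "cinner e (\<Sum>\<^sub>\<infinity>e'\<in>F. cinner e' x *\<^sub>C e') = (if e \<in> F then cinner e x else 0)"
proof (rule has_sum_unique)
  show "((\<lambda>e'. cinner e (cinner e' x *\<^sub>C e')) has_sum
      cinner e (\<Sum>\<^sub>\<infinity>e'\<in>F. cinner e' x *\<^sub>C e')) F"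
    using orthonormal_subset[OF assms(1,2)]
    by (intro has_sum_cinner_right has_sum_infsum summable_on_fourier)
  have "((\<lambda>e'. if e' = e then cinner e x else 0) has_sum
      (if e \<in> F then cinner e x else 0)) F"
    by (cases "e \<in> F") (auto intro!: has_sum_finite_neutralI[of "{e}"] has_sum_0 split: if_splits)
  then show "((\<lambda>e'. cinner e (cinner e' x *\<^sub>C e')) has_sum (if e \<in> F then cinner e x else 0)) F"
    using assms by (subst has_sum_cong) (auto simp: cinner_scaleC_right orthonormalD subset_iff)
qed

lemma fourier_sum_in_closed_subspace:
  assumes "module.subspace (*\<^sub>C) S" "closed S" "E \<subseteq> S" "orthonormal E"
  shows "(\<Sum>\<^sub>\<infinity>e\<in>E. cinner e x *\<^sub>C e) \<in> S"
proof -
  have "(sum (\<lambda>e. cinner e x *\<^sub>C e) \<longlongrightarrow> (\<Sum>\<^sub>\<infinity>e\<in>E. cinner e x *\<^sub>C e)) (finite_subsets_at_top E)"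
    using summable_on_fourier[OF assms(4)] by (simp add: summable_iff_has_sum_infsum has_sum_def)
  moreover have "\<forall>\<^sub>F F in finite_subsets_at_top E. sum (\<lambda>e. cinner e x *\<^sub>C e) F \<in> S"
    using assms(1,3)
    by (intro eventually_finite_subsets_at_top_weakI)
       (auto intro!: cvec.subspace_sum cvec.subspace_scale)
  ultimately show ?thesis
    by (intro Lim_in_closed_set[OF assms(2) _ finite_subsets_at_top_neq_bot])
qed

text \<open>The orthogonal complement of \<open>x\<close> is a closed subspace containing
  \<open>E\<close>, hence the whole space, and so contains \<open>x\<close> itself.\<close>

lemma orthogonal_to_onb:
  assumes "is_onb E" "\<And>e. e \<in> E \<Longrightarrow> cinner e x = 0"
  shows "x = 0"
proof -
  have "module.subspace (*\<^sub>C) {y. cinner x y = 0}"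
    by (rule cvec.subspaceI) (auto simp: cinner.zero_right cinner_add_right cinner_scaleC_right)
  then have "module.span (*\<^sub>C) E \<subseteq> {y. cinner x y = 0}"
    using assms(2) by (intro cvec.span_minimal) (auto simp: cinner_eq_zero_sym[of x])
  moreover have "closed {y. cinner x y = 0}"
    by (intro closed_Collect_eq continuous_intros linear_continuous_on cinner.bounded_linear_right)
  ultimately have "UNIV \<subseteq> {y. cinner x y = 0}"
    using assms(1) by (metis closure_minimal is_onb_def)
  then show ?thesis
    using cinner_self_eq_zero by blast
qed

lemma onb_eqI:
  assumes "is_onb E" "\<And>e. e \<in> E \<Longrightarrow> cinner e x = cinner e y"
  shows "x = y"
  using orthogonal_to_onb[OF assms(1), of "x - y"] assms(2) by (simp add: cinner.diff_right)

lemma onb_expansion: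
  assumes "is_onb E"
  shows "((\<lambda>e. cinner e x *\<^sub>C e) has_sum x) E"
proof -
  have "(\<Sum>\<^sub>\<infinity>e\<in>E. cinner e x *\<^sub>C e) = x"
    using cinner_fourier_sum[OF is_onb_orthonormal[OF assms] subset_refl]
    by (intro onb_eqI[OF assms]) simp
  then show ?thesis
    using summable_on_fourier[OF is_onb_orthonormal[OF assms], of x]
    by (simp add: summable_iff_has_sum_infsum)
qed

lemma parseval:
  assumes "is_onb E"
  shows "((\<lambda>e. cinner y e * cinner e x) has_sum cinner y x) E"
  using has_sum_cinner_right[OF onb_expansion[OF assms], of y x]
  by (simp add: cinner_scaleC_right mult.commute)

lemma parseval_norm:
  assumes "is_onb E"
  shows "((\<lambda>e. (cmod (cinner e x))\<^sup>2) has_sum (norm x)\<^sup>2) E"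
proof -
  have "cinner x e * cinner e x = of_real ((cmod (cinner e x))\<^sup>2)" for e
    by (subst cinner_commute[of x e]) (subst complex_norm_square, rule mult.commute)
  then show ?thesis
    using parseval[OF assms, of x x] by (simp add: cinner_self has_sum_of_real_iff del: of_real_power)
qed

text \<open>The difference of \<open>x\<close> and its Fourier sum is orthogonal to
  \<open>E\<close>, so it vanishes, and \<open>x\<close> is a limit of finite combinations of
  \<open>E\<close>.\<close>

lemma is_onbI:
  assumes E: "orthonormal E" and total: "\<And>x. (\<And>e. e \<in> E \<Longrightarrow> cinner e x = 0) \<Longrightarrow> x = 0"
  shows "is_onb E"
proof -
  have "x \<in> closure (module.span (*\<^sub>C) E)" for x
  proof -
    let ?y = "\<Sum>\<^sub>\<infinity>e\<in>E. cinner e x *\<^sub>C e"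
    have "x - ?y = 0"
      by (rule total) (simp add: cinner.diff_right cinner_fourier_sum[OF E subset_refl])
    then have "x = ?y"
      by simp
    moreover have "(sum (\<lambda>e. cinner e x *\<^sub>C e) \<longlongrightarrow> ?y) (finite_subsets_at_top E)"
      using summable_on_fourier[OF E] by (simp add: summable_iff_has_sum_infsum has_sum_def)
    moreover have "\<forall>\<^sub>F F in finite_subsets_at_top E.
        sum (\<lambda>e. cinner e x *\<^sub>C e) F \<in> closure (module.span (*\<^sub>C) E)"
      by (intro eventually_finite_subsets_at_top_weakI)
        (intro subsetD[OF closure_subset] cvec.span_sum cvec.span_scale cvec.span_base, auto)
    ultimately show ?thesis
      by (metis Lim_in_closed_set[OF closed_closure _ finite_subsets_at_top_neq_bot])
  qed
  then show ?thesis
    using E by (auto simp: is_onb_def orthonormal_def)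
qed

section \<open>Compact symmetric operators\<close>

text \<open>On the unit ball of \<open>N\<close>, a maximizing sequence of \<open>norm (K x)\<close> subconverges to some \<open>z\<close> with
  \<open>K\<^sup>2 z = m\<^sup>2 z\<close>, where \<open>m\<close> is the supremum. As \<open>(K - m) (K + m) z = 0\<close>, either \<open>z\<close> or
  \<open>(K + m) z\<close> is an eigenvector.\<close>

lemma compact_symmetric_eigenvector:
  fixes K :: "'a::real_inner \<Rightarrow> 'a"
  assumes K: "bounded_linear K" and comp: "compact (closure (K ` cball 0 1))"
    and sym: "\<And>x y. inner (K x) y = inner x (K y)"
    and N: "closed N" "subspace N" "K ` N \<subseteq> N"
    and x0: "x0 \<in> N" "K x0 \<noteq> 0"
  obtains l v where "v \<in> N" "v \<noteq> 0" "l \<noteq> 0" "K v = l *\<^sub>R v"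
proof -
  interpret K: bounded_linear K by fact
  define m where "m = (SUP x\<in>N \<inter> cball 0 1. norm (K x))"
  have bdd: "bdd_above ((\<lambda>x. norm (K x)) ` (N \<inter> cball 0 1))"
  proof (rule bdd_aboveI2)
    show "norm (K x) \<le> onorm K" if "x \<in> N \<inter> cball 0 1" for x
      using onorm[OF K, of x] onorm_pos_le[OF K] that
      by (auto intro: order_trans mult_left_le)
  qed
  have norm_K: "norm (K x) \<le> m * norm x" if "x \<in> N" for x
  proof (cases "x = 0")
    case False
    have "norm (K ((1 / norm x) *\<^sub>R x)) \<le> m"
      unfolding m_def using False that N(2)
      by (intro cSUP_upper bdd) (auto intro: subspace_scale)
    with False show ?thesis
      by (simp add: K.scaleR field_simps)
  qed (simp add: K.zero)
  have "m > 0"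
    using norm_K[OF x0(1)] x0(2) by (smt (verit) mult_nonpos_nonneg norm_ge_zero zero_less_norm_iff)
  have "\<exists>x\<in>N \<inter> cball 0 1. m - 1 / real (Suc n) < norm (K x)" for n
    unfolding m_def using less_cSUP_iff[OF _ bdd] subspace_0[OF N(2)]
    by (metis (no_types, lifting) Int_iff centre_in_cball diff_less_eq divide_pos_pos empty_iff
        less_add_same_cancel1 of_nat_0_less_iff zero_less_Suc zero_less_one less_eq_real_def)
  then obtain x where x: "\<And>n. x n \<in> N" "\<And>n. norm (x n) \<le> 1"
      "\<And>n. m - 1 / real (Suc n) < norm (K (x n))"
    by (auto simp: Bex_def) metis
  have "K (x n) \<in> closure (K ` cball 0 1)" for n
    using x(2) by (intro subsetD[OF closure_subset] imageI) simp
  then obtain y r where r: "strict_mono r" "((\<lambda>n. K (x n)) \<circ> r) \<longlonglongrightarrow> y"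
    using comp[unfolded compact_def] by metis
  then have Kx: "(\<lambda>n. K (x (r n))) \<longlonglongrightarrow> y"
    by (simp add: o_def)
  have norm_Kx: "(\<lambda>n. norm (K (x n))) \<longlonglongrightarrow> m"
  proof (rule tendsto_sandwich)
    show "\<forall>\<^sub>F n in sequentially. m - 1 / real (Suc n) \<le> norm (K (x n))"
      using x(3) by (simp add: less_imp_le)
    show "\<forall>\<^sub>F n in sequentially. norm (K (x n)) \<le> m"
    proof (rule always_eventually, rule allI)
      show "norm (K (x n)) \<le> m" for n
        using norm_K[OF x(1)[of n]] x(2)[of n] \<open>m > 0\<close> by (smt (verit) mult_left_le)
    qed
    show "(\<lambda>n. m - 1 / real (Suc n)) \<longlonglongrightarrow> m"
      using tendsto_diff[OF tendsto_const LIMSEQ_inverse_real_of_nat] by (simp add: inverse_eq_divide)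
  qed simp
  have "(\<lambda>n. norm (K (x (r n)))) \<longlonglongrightarrow> m"
    using LIMSEQ_subseq_LIMSEQ[OF norm_Kx r(1)] by (simp add: o_def)
  then have norm_y: "norm y = m"
    using tendsto_norm[OF Kx] LIMSEQ_unique by blast
  \<comment> \<open>\<open>d\<close> measures the failure of \<open>x n\<close> to be an eigenvector
    of the square of \<open>K\<close>. By symmetry the cross term in its squared norm is
    \<open>- 2 * m\<^sup>2 * (norm (K (x n)))\<^sup>2\<close>, and
    \<open>norm (K (K (x n))) \<le> m * norm (K (x n))\<close> because \<open>K\<close> preserves
    \<open>N\<close>; hence \<open>d\<close> tends to 0.\<close>
  define d where "d n = K (K (x n)) - m\<^sup>2 *\<^sub>R x n" for n
  have norm_d: "(norm (d n))\<^sup>2 \<le> m\<^sup>2 * (m\<^sup>2 - (norm (K (x n)))\<^sup>2)" for n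
  proof -
    have "(norm (d n))\<^sup>2 = (norm (K (K (x n))))\<^sup>2 - 2 * m\<^sup>2 * (norm (K (x n)))\<^sup>2 + (m\<^sup>2 * norm (x n))\<^sup>2"
      unfolding d_def power2_norm_eq_inner[of "_ - _"] inner_diff_left inner_diff_right
      by (simp add: sym[of "K (x n)" "x n"] sym[of "x n" "K (x n)", symmetric] inner_commute
          power2_norm_eq_inner[symmetric] power_mult_distrib power2_eq_square[of "m\<^sup>2"] algebra_simps)
    moreover have "norm (K (K (x n))) \<le> m * norm (K (x n))"
      using N(3) x(1) by (intro norm_K) auto
    then have "(norm (K (K (x n))))\<^sup>2 \<le> m\<^sup>2 * (norm (K (x n)))\<^sup>2"
      by (metis norm_ge_zero power_mono power_mult_distrib)
    moreover have "(m\<^sup>2 * norm (x n))\<^sup>2 \<le> (m\<^sup>2)\<^sup>2"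
      using x(2)[of n] by (intro power_mono mult_left_le) auto
    ultimately show ?thesis
      by (simp add: algebra_simps power2_eq_square[of "m\<^sup>2"])
  qed
  have "(\<lambda>n. m\<^sup>2 * (m\<^sup>2 - (norm (K (x n)))\<^sup>2)) \<longlonglongrightarrow> m\<^sup>2 * (m\<^sup>2 - m\<^sup>2)"
    by (intro tendsto_intros norm_Kx)
  then have bound: "(\<lambda>n. m\<^sup>2 * (m\<^sup>2 - (norm (K (x n)))\<^sup>2)) \<longlonglongrightarrow> 0"
    by simp
  have "(\<lambda>n. (norm (d n))\<^sup>2) \<longlonglongrightarrow> 0"
    by (rule tendsto_sandwich[OF _ _ tendsto_const bound])
       (intro always_eventually allI norm_d zero_le_power2)+
  then have "d \<longlonglongrightarrow> 0"
    using tendsto_real_sqrt[of "\<lambda>n. (norm (d n))\<^sup>2" 0] by (simp add: tendsto_norm_zero_iff)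
  then have "(\<lambda>n. d (r n)) \<longlonglongrightarrow> 0"
    using LIMSEQ_subseq_LIMSEQ[OF _ r(1)] by (force simp: o_def)
  \<comment> \<open>Compactness only makes the images \<open>K (x (r n))\<close> converge; solving
    the definition of \<open>d\<close> for \<open>x (r n)\<close> gives convergence of the sequence
    itself.\<close>
  then have "(\<lambda>n. (1 / m\<^sup>2) *\<^sub>R (K (K (x (r n))) - d (r n))) \<longlonglongrightarrow> (1 / m\<^sup>2) *\<^sub>R (K y - 0)"
    by (intro tendsto_intros K.tendsto Kx)
  then have lim_x: "(\<lambda>n. x (r n)) \<longlonglongrightarrow> (1 / m\<^sup>2) *\<^sub>R K y"
    using \<open>m > 0\<close> by (simp add: d_def)
  define z where "z = (1 / m\<^sup>2) *\<^sub>R K y"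
  have z: "z \<in> N"
    using closed_sequentially[OF N(1) _ lim_x] x(1) by (simp add: z_def)
  have "y = K z"
    using LIMSEQ_unique[OF Kx K.tendsto[OF lim_x]] by (simp add: z_def)
  then have KKz: "K (K z) = m\<^sup>2 *\<^sub>R z"
    using \<open>m > 0\<close> by (simp add: z_def)
  have "z \<noteq> 0"
    using \<open>y = K z\<close> norm_y \<open>m > 0\<close> by (auto simp: K.zero)
  define v where "v = K z + m *\<^sub>R z"
  show thesis
  proof (cases "v = 0")
    case True
    then have "K z = (- m) *\<^sub>R z"
      by (simp add: v_def eq_neg_iff_add_eq_0)
    then show thesis
      using that[of z "- m"] z \<open>z \<noteq> 0\<close> \<open>m > 0\<close> by simp
  next
    case False
    have "v \<in> N"
      unfolding v_def using z N by (auto intro!: subspace_add subspace_scale)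
    moreover have "K v = m *\<^sub>R v"
      by (simp add: v_def K.add K.scaleR KKz scaleR_add_right power2_eq_square)
    ultimately show thesis
      using that[of v m] False \<open>m > 0\<close> by simp
  qed
qed

section \<open>Eigenbases of self-adjoint operators with compact inverse\<close>

lemma self_adjoint_op_sym:
  "self_adjoint_op V D \<Longrightarrow> x \<in> V \<Longrightarrow> y \<in> V \<Longrightarrow> cinner (D x) y = cinner x (D y)"
  unfolding self_adjoint_op_def by blast

text \<open>By self-adjointness, testing against \<open>V\<close> forces \<open>z\<close> into
  \<open>V\<close>. The conditions on the right are continuous in \<open>z\<close>, whence
  eigenspaces are closed although \<open>D\<close> need not be continuous.\<close>

lemma self_adjoint_op_eigenspace:
  assumes "self_adjoint_op V D"
  shows "eigenspace V D l = {z. \<forall>x\<in>V. cinner (D x) z = cinner x (l *\<^sub>R z)}"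
  using assms unfolding self_adjoint_op_def eigenspace_def by fastforce

lemma closed_eigenspace:
  assumes "self_adjoint_op V D"
  shows "closed (eigenspace V D l)"
proof -
  have "eigenspace V D l = (\<Inter>x\<in>V. {z. cinner (D x) z = cinner x (l *\<^sub>R z)})"
    unfolding self_adjoint_op_eigenspace[OF assms] by auto
  moreover have "closed {z. cinner (D x) z = cinner x (l *\<^sub>R z)}" for x
    by (intro closed_Collect_eq linear_continuous_on cinner.bounded_linear_right
        bounded_linear_compose[OF cinner.bounded_linear_right bounded_linear_scaleR_right])
  ultimately show ?thesis
    by auto
qed

lemma subspace_eigenspace:
  assumes "self_adjoint_op V D"
  shows "module.subspace (*\<^sub>C) (eigenspace V D l)"
  unfolding self_adjoint_op_eigenspace[OF assms]
  by (rule cvec.subspaceI)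
     (auto simp: cinner_add_right cinner_scaleC_right cinner_scaleR_right cinner.zero_right
       scaleR_add_right algebra_simps)

text \<open>Zorn's lemma gives a maximal orthonormal set \<open>M\<close> of eigenvectors. The
  inverse \<open>K\<close> preserves its orthogonal complement; a nonzero vector there would lead to
  an eigenvector of \<open>K\<close> in it, contradicting maximality. The gap
  \<open>\<delta>\<close> is the reciprocal of a bound for \<open>K\<close>.\<close>

lemma ex_eigenbasis:
  fixes V :: "'a::chilbert_space set"
  assumes sa: "self_adjoint_op V D" and ci: "has_compact_inverse V D"
  obtains E lam \<delta> where "is_onb E" "\<And>e. e \<in> E \<Longrightarrow> e \<in> eigenspace V D (lam e)"
    "\<delta> > 0" "\<And>e. e \<in> E \<Longrightarrow> \<delta> \<le> \<bar>lam e\<bar>"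
proof -
  define K where "K = inv_into V D"
  have bij: "bij_betw D V UNIV" and "compact_op K"
    using ci by (auto simp: has_compact_inverse_def K_def)
  then have K: "bounded_linear K" and comp: "compact (closure (K ` cball 0 1))"
    by (auto simp: compact_op_def bounded_clinear_def)
  interpret K: bounded_linear K by fact
  have DK: "D (K x) = x" for x
    using bij by (simp add: K_def bij_betw_def f_inv_into_f)
  have KV: "K x \<in> V" for x
    using bij inv_into_into[of x D V] by (simp add: K_def bij_betw_def)
  have KD: "K (D x) = x" if "x \<in> V" for x
    using bij that by (simp add: K_def bij_betw_def)
  have sym: "cinner (K x) y = cinner x (K y)" for x y
    using self_adjoint_op_sym[OF sa KV[of x] KV[of y]] by (simp add: DK)
  have V: "module.subspace (*\<^sub>C) V" and D_scale: "\<And>c x. x \<in> V \<Longrightarrow> D (c *\<^sub>C x) = c *\<^sub>C D x"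
    using sa by (auto simp: self_adjoint_op_def)
  have D_scaleR: "D (r *\<^sub>R x) = r *\<^sub>R D x" "r *\<^sub>R x \<in> V" if "x \<in> V" for r x
    using D_scale[OF that, of "of_real r"] cvec.subspace_scale[OF V that, of "of_real r"]
    by (simp_all add: scaleC_of_real)
  define \<A> where "\<A> = {E. orthonormal E \<and> (\<forall>e\<in>E. \<exists>l. e \<in> eigenspace V D l)}"
  have "\<exists>M\<in>\<A>. \<forall>X\<in>\<A>. M \<subseteq> X \<longrightarrow> X = M"
  proof (rule subset_Zorn')
    fix C assume C: "subset.chain \<A> C"
    have "orthonormal (\<Union>C)"
      unfolding orthonormal_def
    proof (intro ballI)
      fix x y assume "x \<in> \<Union>C" "y \<in> \<Union>C"
      then obtain X Y where "X \<in> C" "x \<in> X" "Y \<in> C" "y \<in> Y" by blast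
      moreover from this C have "X \<subseteq> Y \<or> Y \<subseteq> X"
        by (auto simp: subset.chain_def)
      ultimately obtain Z where "Z \<in> C" "x \<in> Z" "y \<in> Z" by blast
      with C show "cinner x y = (if x = y then 1 else 0)"
        by (intro orthonormalD[of Z]) (auto simp: subset.chain_def \<A>_def)
    qed
    with C show "\<Union>C \<in> \<A>"
      by (auto simp: subset.chain_def \<A>_def)
  qed
  then obtain M where M: "orthonormal M" "\<And>e. e \<in> M \<Longrightarrow> \<exists>l. e \<in> eigenspace V D l"
    and max: "\<And>X. X \<in> \<A> \<Longrightarrow> M \<subseteq> X \<Longrightarrow> X = M"
    by (auto simp: \<A>_def)
  from M(2) obtain lam where lam: "\<And>e. e \<in> M \<Longrightarrow> e \<in> eigenspace V D (lam e)"
    by metis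
  \<comment> \<open>Stated multiplied out, since \<open>lam e \<noteq> 0\<close> is itself derived
    from it.\<close>
  have K_lam: "lam e *\<^sub>R K e = e" if "e \<in> M" for e
    using lam[OF that] KD[of e] by (simp add: eigenspace_def K.scaleR)
  have "is_onb M"
  proof (rule is_onbI[OF M(1)], rule ccontr)
    fix x assume x: "\<And>e. e \<in> M \<Longrightarrow> cinner e x = 0" "x \<noteq> 0"
    define N where "N = {x. \<forall>e\<in>M. cinner e x = 0}"
    have "N = (\<Inter>e\<in>M. {x. cinner e x = 0})"
      by (auto simp: N_def)
    then have N_closed: "closed N"
      by (auto intro!: closed_Collect_eq continuous_intros linear_continuous_on
          cinner.bounded_linear_right)
    have N_subspace: "subspace N"
      by (rule subspaceI)
         (auto simp: N_def cinner.zero_right cinner_add_right cinner_scaleR_right)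
    have N_inv: "K ` N \<subseteq> N"
    proof safe
      fix z assume z: "z \<in> N"
      have "cinner e (K z) = 0" if e: "e \<in> M" for e
      proof -
        have "lam e * cinner (K e) z = cinner (lam e *\<^sub>R K e) z"
          by (simp add: cinner_scaleR_left)
        also have "\<dots> = 0"
          using z e by (simp add: K_lam N_def)
        finally have "lam e * cinner (K e) z = 0" .
        moreover have "lam e \<noteq> 0"
          using K_lam[OF e] orthonormal_norm[OF M(1) e] by auto
        ultimately show ?thesis
          by (simp add: sym)
      qed
      then show "K z \<in> N"
        by (simp add: N_def)
    qed
    \<comment> \<open>\<open>K\<close> is injective because \<open>D (K x) = x\<close> and
      \<open>D 0 = 0\<close>.\<close>
    have x_N: "x \<in> N" "K x \<noteq> 0"
      using x DK[of x] D_scaleR[of "K x" 0] KV[of x] by (auto simp: N_def)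
    have inner_sym: "inner (K y) z = inner y (K z)" for y z
      by (simp add: inner_eq_Re_cinner sym)
    obtain l v where v: "v \<in> N" "v \<noteq> 0" "l \<noteq> 0" "K v = l *\<^sub>R v"
      by (rule compact_symmetric_eigenvector[OF K comp inner_sym N_closed N_subspace N_inv x_N])
    define w where "w = (1 / norm v) *\<^sub>R v"
    have "v = (1 / l) *\<^sub>R K v"
      using v by simp
    then have "v \<in> V"
      using D_scaleR(2)[OF KV] by metis
    have "D v = D ((1 / l) *\<^sub>R K v)"
      using \<open>v = (1 / l) *\<^sub>R K v\<close> by simp
    also have "\<dots> = (1 / l) *\<^sub>R v"
      by (simp add: D_scaleR[OF KV] DK)
    finally have w_eig: "w \<in> eigenspace V D (1 / l)"
      using D_scaleR[OF \<open>v \<in> V\<close>] by (simp add: w_def eigenspace_def)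
    have "norm w = 1"
      using v(2) by (simp add: w_def)
    then have ww: "cinner w w = 1"
      by (simp add: cinner_self)
    have wN: "w \<in> N"
      using v(1) N_subspace by (simp add: w_def subspace_scale)
    then have "orthonormal (insert w M)"
      using M(1) ww by (auto simp: orthonormal_def N_def cinner_eq_zero_sym[of w])
    then have "insert w M = M"
      using M(2) w_eig by (intro max) (auto simp: \<A>_def)
    then have "w \<in> M"
      by blast
    with wN have "cinner w w = 0"
      by (simp add: N_def)
    with ww show False
      by simp
  qed
  moreover obtain B where B: "B > 0" "\<And>x. norm (K x) \<le> norm x * B"
    using K.pos_bounded by blast
  have "1 / B \<le> \<bar>lam e\<bar>" if "e \<in> M" for e
  proof -
    have "1 = \<bar>lam e\<bar> * norm (K e)"
      using arg_cong[OF K_lam[OF that], of norm] orthonormal_norm[OF M(1) that] by simp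
    also have "\<dots> \<le> \<bar>lam e\<bar> * B"
      using B(2)[of e] orthonormal_norm[OF M(1) that] by (intro mult_left_mono) auto
    finally show ?thesis
      using B(1) by (simp add: divide_le_eq)
  qed
  ultimately show thesis
    using that[of M lam "1 / B"] lam B(1) by simp
qed

section \<open>Traces\<close>

lemma has_sum_finite_sum:
  assumes "finite G" "\<And>e. e \<in> G \<Longrightarrow> ((h e :: 'i \<Rightarrow> 'b::topological_comm_monoid_add) has_sum s e) F"
  shows "((\<lambda>f. \<Sum>e\<in>G. h e f) has_sum (\<Sum>e\<in>G. s e)) F"
  using assms by (induction G rule: finite_induct) (auto intro!: has_sum_add has_sum_0)

text \<open>An orthonormal basis must be at hand: otherwise every number would meet the condition in
  \<open>op_trace\<close>, and \<open>THE\<close> would be undetermined.\<close>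

lemma op_trace_eqI:
  fixes T :: "'a::chilbert_space \<Rightarrow> 'a" and E :: "'a set"
  assumes "is_onb E" "\<And>F. is_onb F \<Longrightarrow> ((\<lambda>e. cinner e (T e)) has_sum t) F"
  shows "op_trace T = t"
  unfolding op_trace_def
proof (rule the_equality)
  show "t' = t" if "\<forall>E. is_onb E \<longrightarrow> ((\<lambda>e. cinner e (T e)) has_sum t') E" for t'
    using that assms(1) has_sum_unique[OF _ assms(2)[OF assms(1)]] by blast
qed (use assms(2) in blast)

lemma bounded_clinear_bounded: "bounded_clinear A \<Longrightarrow> bounded_linear A"
  and bounded_clinear_scaleC: "bounded_clinear A \<Longrightarrow> A (c *\<^sub>C x) = c *\<^sub>C A x"
  by (simp_all add: bounded_clinear_def)

text \<open>The double series \<open>\<Sum>\<^sub>e \<Sum>\<^sub>f c\<^sub>e \<langle>f, e\<rangle> \<langle>e, A f\<rangle>\<close> converges absolutely: with unimodular \<open>u\<^sub>f\<close>, a finite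
  sum \<open>\<Sum>\<^sub>f |\<langle>f, e\<rangle> \<langle>e, A f\<rangle>|\<close> is \<open>\<langle>e, A y\<rangle>\<close> for \<open>y = \<Sum>\<^sub>f u\<^sub>f \<langle>f, e\<rangle> f\<close>, and \<open>norm y \<le> 1\<close> by Bessel.\<close>

lemma has_sum_cinner_diag_comp:
  assumes E: "is_onb E" and F: "is_onb F" and A: "bounded_clinear A"
    and T: "\<And>e y. e \<in> E \<Longrightarrow> cinner e (T y) = c e * cinner e y"
    and c: "(\<lambda>e. cmod (c e)) summable_on E"
  shows "((\<lambda>f. cinner f (T (A f))) has_sum (\<Sum>\<^sub>\<infinity>e\<in>E. c e * cinner e (A e))) F"
proof -
  interpret A: bounded_linear A
    by (rule bounded_clinear_bounded[OF A])
  obtain M where M: "M > 0" "\<And>x. norm (A x) \<le> norm x * M"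
    using A.pos_bounded by blast
  define q where "q e f = cinner f e * cinner e (A f)" for e f
  have q_bound: "(\<Sum>f\<in>G. cmod (q e f)) \<le> M" if e: "e \<in> E" and G: "finite G" "G \<subseteq> F" for e G
  proof -
    have "\<exists>u. cmod u = 1 \<and> u * q e f = of_real (cmod (q e f))" for f
      by (metis unimodular_factor)
    then obtain u where u: "\<And>f. cmod (u f) = 1" "\<And>f. u f * q e f = of_real (cmod (q e f))"
      by metis
    define y where "y = (\<Sum>f\<in>G. (u f * cinner f e) *\<^sub>C f)"
    have "cinner e (A y) = (\<Sum>f\<in>G. u f * q e f)"
      by (simp add: y_def A.sum bounded_clinear_scaleC[OF A] cinner.sum_right cinner_scaleC_right q_def
          mult.assoc)
    also have "\<dots> = of_real (\<Sum>f\<in>G. cmod (q e f))"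
      by (simp add: u)
    finally have "(\<Sum>f\<in>G. cmod (q e f)) = cmod (cinner e (A y))"
      by (simp add: sum_nonneg del: of_real_sum)
    also have "\<dots> \<le> norm e * (norm y * M)"
      by (intro order_trans[OF norm_cinner_le] mult_left_mono M) simp
    also have "norm e = 1"
      using E e by (intro orthonormal_norm is_onb_orthonormal)
    also have "(norm y)\<^sup>2 = (\<Sum>f\<in>G. (cmod (cinner f e))\<^sup>2)"
      unfolding y_def using F G
      by (subst norm_sum_orthonormal[of F]) (auto simp: is_onb_orthonormal norm_mult u)
    then have "(norm y)\<^sup>2 \<le> 1\<^sup>2"
      using bessel[OF is_onb_orthonormal[OF F] G, of e] \<open>norm e = 1\<close> by simp
    then have "norm y \<le> 1"
      by (rule power2_le_imp_le) simp
    then have "1 * (norm y * M) \<le> M"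
      using M(1) by simp
    finally show ?thesis .
  qed
  have q_summable: "(\<lambda>f. cmod (q e f)) summable_on F" if "e \<in> E" for e
    by (rule nonneg_bdd_above_summable_on) (auto intro!: bdd_aboveI2[of _ _ M] q_bound that)
  have q_infsum: "(\<Sum>\<^sub>\<infinity>f\<in>F. cmod (q e f)) \<le> M" if "e \<in> E" for e
    by (intro infsum_le_finite_sums q_summable q_bound that)
  define h where "h = (\<lambda>(e, f). c e * q e f)"
  have "(\<lambda>p. norm (h p)) summable_on E \<times> F"
    unfolding Infinite_Sum.abs_summable_on_Sigma_iff
  proof (intro conjI ballI)
    show "(\<lambda>f. cmod (h (e, f))) summable_on F" if "e \<in> E" for e
      using q_summable[OF that] by (simp add: h_def norm_mult summable_on_cmult_right)
    have "(\<lambda>e. cmod (c e) * M) summable_on E"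
      using c by (rule summable_on_cmult_left)
    then show "(\<lambda>e. norm (\<Sum>\<^sub>\<infinity>f\<in>F. cmod (h (e, f)))) summable_on E"
    proof (rule Infinite_Sum.abs_summable_on_comparison_test')
      show "norm (\<Sum>\<^sub>\<infinity>f\<in>F. cmod (h (e, f))) \<le> cmod (c e) * M" if "e \<in> E" for e
        using q_infsum[OF that]
        by (simp add: h_def norm_mult infsum_cmult_right' infsum_nonneg mult_left_mono)
    qed
  qed
  then have "h summable_on E \<times> F"
    by (rule Infinite_Sum.abs_summable_summable)
  then obtain S where S: "(h has_sum S) (E \<times> F)"
    by (auto simp: summable_on_def)
  \<comment> \<open>The double sum is evaluated in both orders: over \<open>f\<close> first, by
    expanding \<open>e\<close> in the basis \<open>F\<close>, and below over \<open>e\<close> first,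
    by Parseval in \<open>E\<close>.\<close>
  have "((\<lambda>e. c e * cinner e (A e)) has_sum S) E"
  proof (rule has_sum_Sigma'[OF S])
    fix e assume "e \<in> E"
    have "((\<lambda>f. cinner e (A (cinner f e *\<^sub>C f))) has_sum cinner e (A e)) F"
      by (intro has_sum_cinner_right has_sum_bounded_linear[OF A.bounded_linear_axioms]
          onb_expansion F)
    then show "((\<lambda>f. h (e, f)) has_sum c e * cinner e (A e)) F"
      by (auto simp: h_def q_def bounded_clinear_scaleC[OF A] cinner_scaleC_right
          intro!: has_sum_cmult_right)
  qed
  moreover have "((\<lambda>f. cinner f (T (A f))) has_sum S) F"
  proof (rule has_sum_Sigma')
    show "((\<lambda>(f, e). h (e, f)) has_sum S) (F \<times> E)"
      using S by (subst (asm) has_sum_swap)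
    show "((\<lambda>e. case (f, e) of (f, e) \<Rightarrow> h (e, f)) has_sum cinner f (T (A f))) E" if "f \<in> F" for f
    proof -
      have "((\<lambda>e. cinner f e * cinner e (T (A f))) has_sum cinner f (T (A f))) E"
        by (rule parseval[OF E])
      then show ?thesis
        by (rule has_sum_cong[THEN iffD1, rotated]) (simp add: h_def q_def T)
    qed
  qed
  ultimately show ?thesis
    by (simp add: infsumI)
qed

text \<open>Polarization. The sesquilinear form \<open>N\<close> is zero on the diagonal, as
  \<open>cinner z (P z)\<close> is real; its values at \<open>x + y\<close> and
  \<open>x + \<i> *\<^sub>C y\<close> show that \<open>N x y + N y x\<close> and
  \<open>N x y - N y x\<close> vanish.\<close>

lemma positive_op_sym:
  assumes "positive_op P"
  shows "cinner x (P y) = cinner (P x) y"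
proof -
  interpret P: bounded_linear P
    using assms by (simp add: positive_op_def bounded_clinear_def)
  have P_scale: "P (c *\<^sub>C x) = c *\<^sub>C P x" for c x
    using assms by (simp add: positive_op_def bounded_clinear_def)
  define N where "N x y = cinner x (P y) - cinner (P x) y" for x y
  have N0: "N z z = 0" for z
    using assms by (metis N_def Reals_cnj_iff cinner_commute positive_op_def right_minus_eq)
  have "N x y + N y x = N (x + y) (x + y) - N x x - N y y"
    by (simp add: N_def P.add cinner_add_left cinner_add_right algebra_simps)
  moreover have "\<i> * (N x y - N y x) = N (x + \<i> *\<^sub>C y) (x + \<i> *\<^sub>C y) - N x x - N y y"
    by (simp add: N_def P.add P_scale cinner_add_left cinner_add_right cinner_scaleC_left
        cinner_scaleC_right algebra_simps)
  ultimately have "N x y = 0"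
    by (simp add: N0)
  then show ?thesis
    by (simp add: N_def)
qed

text \<open>If \<open>P\<^sup>2 e = h\<^sup>2 e\<close>, then \<open>v = (P - h) e\<close> satisfies \<open>P v = - h v\<close>, which is impossible for
  positive \<open>P\<close> unless \<open>v = 0\<close>.\<close>

lemma is_abs_op_eigenvector:
  assumes abs: "is_abs_op T P" and "h > 0"
    and T: "\<And>x. cinner (T e) (T x) = of_real (h\<^sup>2) * cinner e x"
  shows "P e = h *\<^sub>R e"
proof -
  have pos: "positive_op P" and PT: "\<And>x y. cinner (P x) (P y) = cinner (T x) (T y)"
    using abs by (auto simp: is_abs_op_def)
  interpret P: bounded_linear P
    using pos by (simp add: positive_op_def bounded_clinear_def)
  have "cinner (P (P e) - h\<^sup>2 *\<^sub>R e) x = 0" for x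
    using positive_op_sym[OF pos, of "P e" x] PT[of e x] T[of x]
    by (simp add: cinner.diff_left cinner_scaleR_left)
  then have PP: "P (P e) = h\<^sup>2 *\<^sub>R e"
    by (metis cinner_self_eq_zero right_minus_eq)
  define v where "v = P e - h *\<^sub>R e"
  have "P v = (- h) *\<^sub>R v"
    by (simp add: v_def P.diff P.scaleR PP scaleR_diff_right power2_eq_square)
  then have "Re (cinner v (P v)) = - h * (norm v)\<^sup>2"
    by (simp only: cinner_scaleR_right cinner_self flip: of_real_mult) simp
  then have "h * (norm v)\<^sup>2 \<le> 0"
    using pos by (metis positive_op_def mult_minus_left neg_0_le_iff_le)
  then have "v = 0"
    using \<open>h > 0\<close> by (simp add: mult_le_0_iff)
  then show ?thesis
    by (simp add: v_def)
qed

section \<open>Functional calculus in an eigenbasis\<close>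

locale eigenbasis =
  fixes V :: "'a::chilbert_space set" and D :: "'a \<Rightarrow> 'a" and E :: "'a set" and lam :: "'a \<Rightarrow> real"
  assumes self_adjoint: "self_adjoint_op V D"
    and onb: "is_onb E"
    and eigen: "\<And>e. e \<in> E \<Longrightarrow> e \<in> eigenspace V D (lam e)"
begin

lemma orthonormal: "orthonormal E"
  by (rule is_onb_orthonormal[OF onb])

lemma eigenspaces_orthogonal:
  assumes "x \<in> eigenspace V D l" "y \<in> eigenspace V D l'" "l \<noteq> l'"
  shows "cinner x y = 0"
proof -
  have "of_real l * cinner x y = of_real l' * cinner x y"
    using self_adjoint_op_sym[OF self_adjoint, of x y] assms
    by (simp add: eigenspace_def cinner_scaleR_left cinner_scaleR_right)
  with assms(3) show ?thesis
    by simp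
qed

text \<open>The definite description is resolved by the Fourier sum over the basis vectors with
  eigenvalue \<open>l\<close>. Its difference from \<open>x\<close> is orthogonal to the eigenspace,
  since an eigenvector for \<open>l\<close> has no components along the other basis vectors.\<close>

lemma
  shows orth_proj_in: "orth_proj (eigenspace V D l) x \<in> eigenspace V D l" (is ?in)
    and orth_proj_orth: "z \<in> eigenspace V D l \<Longrightarrow>
      cinner z (x - orth_proj (eigenspace V D l) x) = 0" (is "_ \<Longrightarrow> ?orth")
    and cinner_orth_proj: "e \<in> E \<Longrightarrow>
      cinner e (orth_proj (eigenspace V D l) x) = (if lam e = l then cinner e x else 0)"
      (is "_ \<Longrightarrow> ?coeff")
proof -
  let ?S = "eigenspace V D l"
  define F where "F = {e \<in> E. lam e = l}"
  have F: "F \<subseteq> E" "F \<subseteq> ?S"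
    using eigen by (auto simp: F_def)
  define y where "y = (\<Sum>\<^sub>\<infinity>e\<in>F. cinner e x *\<^sub>C e)"
  have y: "y \<in> ?S"
    unfolding y_def using F orthonormal self_adjoint
    by (intro fourier_sum_in_closed_subspace)
      (auto intro: closed_eigenspace subspace_eigenspace orthonormal_subset)
  have coeff: "cinner e y = (if lam e = l then cinner e x else 0)" if "e \<in> E" for e
    using cinner_fourier_sum[OF orthonormal F(1) that] that by (auto simp: y_def F_def)
  have orth: "cinner z (x - y) = 0" if z: "z \<in> ?S" for z
  proof -
    have "cinner z e * cinner e (x - y) = 0" if "e \<in> E" for e
      using eigenspaces_orthogonal[OF z eigen[OF that]] coeff[OF that]
      by (auto simp: cinner.diff_right)
    then have "((\<lambda>e. cinner z e * cinner e (x - y)) has_sum 0) E"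
      by (intro has_sum_0)
    then show ?thesis
      using parseval[OF onb] has_sum_unique by blast
  qed
  have "orth_proj ?S x = y"
    unfolding orth_proj_def
  proof (rule the_equality)
    fix y' assume y': "y' \<in> ?S \<and> (\<forall>z\<in>?S. cinner z (x - y') = 0)"
    have "y - y' \<in> ?S"
      using y y' subspace_eigenspace[OF self_adjoint] by (intro cvec.subspace_diff) auto
    then have "cinner (y - y') (x - y') = 0" "cinner (y - y') (x - y) = 0"
      using y' orth by auto
    then have "cinner (y - y') (y - y') = 0"
      by (simp add: cinner.diff_right)
    then show "y' = y"
      by (simp add: cinner_self_eq_zero)
  qed (use y orth in blast)
  then show ?in and "z \<in> ?S \<Longrightarrow> ?orth" and "e \<in> E \<Longrightarrow> ?coeff"
    using y orth coeff by simp_all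
qed

lemma lam_eigenvalue: "e \<in> E \<Longrightarrow> lam e \<in> eigenvalues V D"
proof -
  assume e: "e \<in> E"
  then have "e \<noteq> 0"
    using orthonormal_norm[OF orthonormal e] by auto
  with eigen[OF e] show "lam e \<in> eigenvalues V D"
    unfolding eigenvalues_def by blast
qed

text \<open>Only the term at \<open>lam e\<close> survives, whatever \<open>g\<close> is;
  \<open>trace_class_fun_calcD\<close> relies on this where no bound on the multiplier is known
  yet.\<close>

lemma fun_calc_basis:
  assumes "e \<in> E"
  shows "fun_calc V D g e = g (lam e) *\<^sub>C e"
proof -
  have proj: "orth_proj (eigenspace V D l) e = (if l = lam e then e else 0)" for l
    using assms
    by (intro onb_eqI[OF onb]) (auto simp: cinner_orth_proj orthonormalD[OF orthonormal] cinner.zero_right)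
  have "((\<lambda>l. g l *\<^sub>C orth_proj (eigenspace V D l) e) has_sum g (lam e) *\<^sub>C e) (eigenvalues V D)"
    using lam_eigenvalue[OF assms]
    by (intro has_sum_finite_neutralI[of "{lam e}"]) (auto simp: proj split: if_splits)
  then show ?thesis
    unfolding fun_calc_def by (rule infsumI)
qed

text \<open>The bound makes the defining sum converge, by orthogonality of the eigenprojections and
  Bessel; for a divergent sum \<open>infsum\<close> would be 0 by default.\<close>

lemma cinner_fun_calc:
  assumes g: "\<And>e. e \<in> E \<Longrightarrow> cmod (g (lam e)) \<le> C" and e: "e \<in> E"
  shows "cinner e (fun_calc V D g x) = g (lam e) * cinner e x"
proof -
  let ?P = "\<lambda>l. orth_proj (eigenspace V D l) x"
  have P_orth: "inner (?P l) (?P l') = 0" if "l \<noteq> l'" for l l'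
    using eigenspaces_orthogonal[OF orth_proj_in orth_proj_in that] by (simp add: inner_eq_Re_cinner)
  have P_x: "inner (?P l) x = (norm (?P l))\<^sup>2" for l
    using orth_proj_orth[OF orth_proj_in, of l x x]
    by (simp add: inner_eq_Re_cinner cinner.diff_right cinner_self)
  have "C \<ge> 0"
    using g[OF e] by (metis norm_ge_zero order_trans)
  \<comment> \<open>\<open>g\<close> is controlled only at the values \<open>lam e\<close>; at any
    other \<open>l\<close> the projection has no component along \<open>E\<close> and is
    zero.\<close>
  have norm_P: "norm (g l *\<^sub>C ?P l) \<le> C * norm (?P l)" for l
  proof (cases "l \<in> lam ` E")
    case True
    then show ?thesis
      using g by (auto simp: norm_scaleC intro!: mult_right_mono)
  next
    case False
    then have "?P l = 0"
      by (intro orthogonal_to_onb[OF onb]) (auto simp: cinner_orth_proj)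
    then show ?thesis
      by (simp add: norm_scaleC)
  qed
  have "(\<lambda>l. g l *\<^sub>C ?P l) summable_on eigenvalues V D"
  proof (rule summable_on_orthogonal)
    show "inner (g l *\<^sub>C ?P l) (g l' *\<^sub>C ?P l') = 0" if "l \<noteq> l'" for l l'
      using eigenspaces_orthogonal[OF orth_proj_in orth_proj_in that]
      by (simp add: inner_eq_Re_cinner cinner_scaleC_left cinner_scaleC_right)
    fix F :: "real set" assume "finite F"
    have "(\<Sum>l\<in>F. (norm (g l *\<^sub>C ?P l))\<^sup>2) \<le> (\<Sum>l\<in>F. C\<^sup>2 * (norm (?P l))\<^sup>2)"
      using norm_P by (intro sum_mono) (metis norm_ge_zero power_mono power_mult_distrib)
    also have "\<dots> \<le> C\<^sup>2 * (norm x)\<^sup>2"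
      using bessel_orthogonal[OF \<open>finite F\<close> P_orth P_x] by (simp add: mult_left_mono flip: sum_distrib_left)
    finally show "(\<Sum>l\<in>F. (norm (g l *\<^sub>C ?P l))\<^sup>2) \<le> C\<^sup>2 * (norm x)\<^sup>2" .
  qed
  then have "((\<lambda>l. cinner e (g l *\<^sub>C ?P l)) has_sum cinner e (fun_calc V D g x)) (eigenvalues V D)"
    unfolding fun_calc_def by (intro has_sum_cinner_right has_sum_infsum)
  moreover have "((\<lambda>l. cinner e (g l *\<^sub>C ?P l)) has_sum g (lam e) * cinner e x) (eigenvalues V D)"
    using lam_eigenvalue[OF e] e
    by (intro has_sum_finite_neutralI[of "{lam e}"])
       (auto simp: cinner_scaleC_right cinner_orth_proj split: if_splits)
  ultimately show ?thesis
    by (rule has_sum_unique)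
qed

section \<open>Boundedness and traces of functions of \<open>D\<close>\<close>

lemma bounded_clinear_fun_calc:
  assumes g: "\<And>e. e \<in> E \<Longrightarrow> cmod (g (lam e)) \<le> C"
  shows "bounded_clinear (fun_calc V D g)"
proof -
  let ?T = "fun_calc V D g"
  note coeff = cinner_fun_calc[where g = g, OF g]
  have add: "?T (x + y) = ?T x + ?T y" for x y
    by (rule onb_eqI[OF onb]) (simp add: coeff cinner_add_right distrib_left)
  have scale: "?T (c *\<^sub>C x) = c *\<^sub>C ?T x" for c x
    by (rule onb_eqI[OF onb]) (simp add: coeff cinner_scaleC_right)
  \<comment> \<open>The absolute value is taken because \<open>C\<close> may be negative when
    \<open>E\<close> is empty.\<close>
  have "norm (?T x) \<le> norm x * \<bar>C\<bar>" for x
  proof (rule power2_le_imp_le)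
    have "((\<lambda>e. \<bar>C\<bar>\<^sup>2 * (cmod (cinner e x))\<^sup>2) has_sum \<bar>C\<bar>\<^sup>2 * (norm x)\<^sup>2) E"
      by (intro has_sum_cmult_right parseval_norm[OF onb])
    moreover have "(cmod (cinner e (?T x)))\<^sup>2 \<le> \<bar>C\<bar>\<^sup>2 * (cmod (cinner e x))\<^sup>2" if "e \<in> E" for e
      using g[OF that] power_mono[of "cmod (g (lam e))" C 2]
      by (simp add: coeff that norm_mult power_mult_distrib mult_right_mono)
    ultimately have "(norm (?T x))\<^sup>2 \<le> \<bar>C\<bar>\<^sup>2 * (norm x)\<^sup>2"
      by (intro has_sum_mono[OF parseval_norm[OF onb]])
    then show "(norm (?T x))\<^sup>2 \<le> (norm x * \<bar>C\<bar>)\<^sup>2"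
      by (simp add: power_mult_distrib mult.commute)
  qed simp
  then have "bounded_linear ?T"
    using scale[of "of_real _"] by (intro bounded_linear_intro[of _ "\<bar>C\<bar>"]) (auto simp: add scaleC_of_real)
  then show ?thesis
    by (simp add: bounded_clinear_def scale)
qed

lemma op_trace_fun_calc_comp:
  assumes A: "bounded_clinear A" and g: "(\<lambda>e. cmod (g (lam e))) summable_on E"
  shows "op_trace (fun_calc V D g \<circ> A) = (\<Sum>\<^sub>\<infinity>e\<in>E. g (lam e) * cinner e (A e))"
proof (rule op_trace_eqI[OF onb])
  have "cmod (g (lam e)) \<le> (\<Sum>\<^sub>\<infinity>e\<in>E. cmod (g (lam e)))" if "e \<in> E" for e
    using finite_sum_le_infsum[OF g, of "{e}"] that by simp
  from cinner_fun_calc[where g = g, OF this]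
  show "((\<lambda>f. cinner f ((fun_calc V D g \<circ> A) f)) has_sum (\<Sum>\<^sub>\<infinity>e\<in>E. g (lam e) * cinner e (A e))) F"
    if "is_onb F" for F
    using has_sum_cinner_diag_comp[OF onb that A _ g] by simp
qed

lemma op_trace_fun_calc:
  assumes g: "(\<lambda>e. cmod (g (lam e))) summable_on E"
  shows "op_trace (fun_calc V D g) = (\<Sum>\<^sub>\<infinity>e\<in>E. g (lam e))"
proof -
  have "bounded_clinear (\<lambda>x::'a. x)"
    by (simp add: bounded_clinear_def bounded_linear_ident)
  from op_trace_fun_calc_comp[OF this g]
  have "op_trace (fun_calc V D g) = (\<Sum>\<^sub>\<infinity>e\<in>E. g (lam e) * cinner e e)"
    by (simp add: o_def)
  also have "\<dots> = (\<Sum>\<^sub>\<infinity>e\<in>E. g (lam e))"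
    by (intro infsum_cong) (simp add: orthonormalD[OF orthonormal])
  finally show ?thesis .
qed

text \<open>For nonnegative \<open>h\<close> the operator is positive, hence its own absolute value,
  and its diagonal in the basis \<open>E\<close> consists of the numbers
  \<open>h (lam e)\<close>.\<close>

lemma trace_class_fun_calcI:
  assumes h: "(\<lambda>e. h (lam e)) summable_on E" "\<And>e. e \<in> E \<Longrightarrow> h (lam e) \<ge> (0::real)"
  shows "trace_class (fun_calc V D (\<lambda>l. of_real (h l)))" (is "trace_class ?T")
proof -
  have "cmod (of_real (h (lam e))) \<le> (\<Sum>\<^sub>\<infinity>e\<in>E. h (lam e))" if "e \<in> E" for e
    using finite_sum_le_infsum[OF h(1), of "{e}"] that h(2) by simp
  note bdd = bounded_clinear_fun_calc[of "\<lambda>l. of_real (h l)", OF this]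
    and coeff = cinner_fun_calc[of "\<lambda>l. of_real (h l)", OF this]
  have "cinner x (?T x) \<in> \<real> \<and> 0 \<le> Re (cinner x (?T x))" for x
  proof -
    have "cinner x e * cinner e (?T x) = of_real (h (lam e) * (cmod (cinner e x))\<^sup>2)" if "e \<in> E" for e
      using coeff[OF _ that] cinner_commute[of x e]
      by (simp add: complex_norm_square[of "cinner e x"] del: of_real_power)
    then have "((\<lambda>e. complex_of_real (h (lam e) * (cmod (cinner e x))\<^sup>2)) has_sum cinner x (?T x)) E"
      using parseval[OF onb, of x "?T x"] by (simp cong: has_sum_cong)
    from has_sum_Re[OF this] has_sum_Im[OF this]
    have "((\<lambda>e. h (lam e) * (cmod (cinner e x))\<^sup>2) has_sum Re (cinner x (?T x))) E"
      "((\<lambda>e. 0) has_sum Im (cinner x (?T x))) E"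
      by simp_all
    moreover from this(2) have "Im (cinner x (?T x)) = 0"
      by (rule has_sum_unique) simp
    ultimately show ?thesis
      using h(2) by (simp add: complex_is_Real_iff) (erule has_sum_nonneg, simp)
  qed
  then have "is_abs_op ?T ?T"
    using bdd by (simp add: is_abs_op_def positive_op_def)
  moreover have "(\<lambda>e. cinner e (?T e)) summable_on E"
  proof -
    have "(\<lambda>e. complex_of_real (h (lam e))) summable_on E"
      using h(1) by (rule summable_on_of_real)
    then show ?thesis
      by (rule summable_on_cong[THEN iffD1, rotated])
        (simp add: fun_calc_basis cinner_scaleC_right orthonormalD[OF orthonormal])
  qed
  ultimately show ?thesis
    using bdd onb by (auto simp: trace_class_def)
qed

text \<open>The definition offers summability of the diagonal of \<open>P\<close> in some basis
  \<open>F\<close> unrelated to \<open>E\<close>. On \<open>E\<close> the operator \<open>P\<close>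
  multiplies by \<open>h (lam e)\<close>; expanding the norms of finitely many vectors of
  \<open>E\<close> in \<open>F\<close> bounds the partial sums over \<open>E\<close> by the trace
  over \<open>F\<close>.\<close>

lemma trace_class_fun_calcD:
  assumes T: "trace_class (fun_calc V D (\<lambda>l. of_real (h l)))" (is "trace_class ?T")
    and h: "\<And>e. e \<in> E \<Longrightarrow> h (lam e) > (0::real)"
  shows "(\<lambda>e. h (lam e)) summable_on E"
proof -
  from T obtain P F where bdd: "bounded_clinear ?T" and P: "is_abs_op ?T P" and F: "is_onb F"
    and summable: "(\<lambda>f. cinner f (P f)) summable_on F"
    by (auto simp: trace_class_def)
  interpret T: bounded_linear ?T
    by (rule bounded_clinear_bounded[OF bdd])
  have pos: "positive_op P"
    using P by (simp add: is_abs_op_def)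
  \<comment> \<open>\<open>cinner_fun_calc\<close> would require a bound on \<open>h\<close>;
    instead, the boundedness of the operator allows applying it termwise to the expansion of
    \<open>x\<close>.\<close>
  have coeff: "cinner e (?T x) = of_real (h (lam e)) * cinner e x" if e: "e \<in> E" for e x
  proof -
    have "((\<lambda>e'. cinner e (?T (cinner e' x *\<^sub>C e'))) has_sum cinner e (?T x)) E"
      by (intro has_sum_cinner_right has_sum_bounded_linear[OF T.bounded_linear_axioms]
          onb_expansion onb)
    moreover have "((\<lambda>e'. cinner e (?T (cinner e' x *\<^sub>C e'))) has_sum
        of_real (h (lam e)) * cinner e x) E"
      using e by (intro has_sum_finite_neutralI[of "{e}"])
        (auto simp: bounded_clinear_scaleC[OF bdd] fun_calc_basis cinner_scaleC_right
          orthonormalD[OF orthonormal] split: if_splits)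
    ultimately show ?thesis
      by (rule has_sum_unique)
  qed
  have P_basis: "P e = h (lam e) *\<^sub>R e" if e: "e \<in> E" for e
  proof (rule is_abs_op_eigenvector[OF P h[OF e]])
    show "cinner (?T e) (?T x) = of_real ((h (lam e))\<^sup>2) * cinner e x" for x
      using e by (simp add: fun_calc_basis[OF e] cinner_scaleC_left coeff power2_eq_square)
  qed
  have P_coeff: "cinner e (P x) = of_real (h (lam e)) * cinner e x" if "e \<in> E" for e x
    using that by (simp add: positive_op_sym[OF pos] P_basis cinner_scaleR_left)
  have diag: "((\<lambda>e. h (lam e) * (cmod (cinner e f))\<^sup>2) has_sum Re (cinner f (P f))) E" for f
  proof -
    have "cinner f e * cinner e (P f) = of_real (h (lam e) * (cmod (cinner e f))\<^sup>2)" if "e \<in> E" for e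
      using P_coeff[OF that] cinner_commute[of f e]
      by (simp add: complex_norm_square[of "cinner e f"] del: of_real_power)
    then have "((\<lambda>e. complex_of_real (h (lam e) * (cmod (cinner e f))\<^sup>2)) has_sum cinner f (P f)) E"
      using parseval[OF onb, of f "P f"] by (simp cong: has_sum_cong)
    from has_sum_Re[OF this] show ?thesis
      by simp
  qed
  show ?thesis
  proof (rule nonneg_bdd_above_summable_on)
    show "bdd_above (sum (\<lambda>e. h (lam e)) ` {G. G \<subseteq> E \<and> finite G})"
    proof (rule bdd_aboveI2)
      fix G assume "G \<in> {G. G \<subseteq> E \<and> finite G}"
      then have G: "G \<subseteq> E" "finite G"
        by auto
      have "((\<lambda>f. \<Sum>e\<in>G. h (lam e) * (cmod (cinner f e))\<^sup>2) has_sum (\<Sum>e\<in>G. h (lam e) * (norm e)\<^sup>2)) F"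
        using G(2) by (intro has_sum_finite_sum has_sum_cmult_right parseval_norm F)
      moreover have "((\<lambda>f. Re (cinner f (P f))) has_sum (\<Sum>\<^sub>\<infinity>f\<in>F. Re (cinner f (P f)))) F"
        using summable by (intro has_sum_infsum summable_on_Re)
      moreover have "(\<Sum>e\<in>G. h (lam e) * (cmod (cinner f e))\<^sup>2) \<le> Re (cinner f (P f))" for f
        unfolding cmod_cinner_commute[of f]
        using less_imp_le[OF h] by (intro finite_sum_le_has_sum[OF diag[of f] G(2,1)]) auto
      ultimately have "(\<Sum>e\<in>G. h (lam e) * (norm e)\<^sup>2) \<le> (\<Sum>\<^sub>\<infinity>f\<in>F. Re (cinner f (P f)))"
        by (rule has_sum_mono)
      moreover have "(\<Sum>e\<in>G. h (lam e) * (norm e)\<^sup>2) = (\<Sum>e\<in>G. h (lam e))"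
        using G by (intro sum.cong) (auto simp: orthonormal_norm[OF orthonormal])
      ultimately show "(\<Sum>e\<in>G. h (lam e)) \<le> (\<Sum>\<^sub>\<infinity>f\<in>F. Re (cinner f (P f)))"
        by simp
    qed
  qed (use h less_imp_le in blast)
qed

end

section \<open>Analytic preliminaries\<close>

lemma powr_le_exp:
  assumes "y > 0" "c > (0::real)"
  shows "y powr c \<le> c powr c * exp y"
proof -
  have "y / c \<le> exp (y / c)"
    using exp_ge_add_one_self[of "y / c"] by linarith
  then have "(y / c) powr c \<le> exp (y / c) powr c"
    using assms by (intro powr_mono2) auto
  also have "\<dots> = exp y"
    using assms by (simp add: powr_def)
  finally show ?thesis
    using assms by (simp add: powr_divide divide_le_eq mult.commute)
qed

text \<open>Euler's integral for \<open>Gamma z\<close> under the substitution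
  \<open>t = m * exp (- x)\<close>, which carries the real line onto the open half-line.\<close>

lemma has_bochner_integral_Gamma_exp:
  assumes z: "z > 0" and m: "m > (0::real)"
  shows "has_bochner_integral lebesgue (\<lambda>x. exp (- z * x) * exp (- m * exp (- x)))
    (Gamma z * m powr (- z))"
proof -
  define f where "f t = t powr (z - 1) / exp t" for t :: real
  define g where "g x = m * exp (- x)" for x :: real
  have "(f has_integral Gamma z) {0..}"
    unfolding f_def by (rule Gamma_integral_real[OF z])
  then have "((\<lambda>t. if t \<in> {0<..} then f t else 0) has_integral Gamma z) {0..}"
    by (rule has_integral_spike[of "{0}", rotated 2]) auto
  then have f_int: "(f has_integral Gamma z) {0<..}"
    by (subst (asm) has_integral_restrict) auto
  then have "f absolutely_integrable_on {0<..}"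
    by (intro nonnegative_absolutely_integrable_1) (auto simp: f_def integrable_on_def)
  moreover have "range g = {0<..}"
  proof (intro equalityI subsetI)
    fix y :: real assume "y \<in> {0<..}"
    then have "y = g (- ln (y / m))"
      using m by (simp add: g_def)
    then show "y \<in> range g" by blast
  qed (use m in \<open>auto simp: g_def\<close>)
  moreover have "(g has_real_derivative (- g x)) (at x within UNIV)" for x
    unfolding g_def by (auto intro!: derivative_eq_intros)
  moreover have "inj g"
    using m by (auto simp: inj_on_def g_def)
  ultimately have
    "(\<lambda>x. \<bar>- g x\<bar> * f (g x)) absolutely_integrable_on UNIV \<and>
      integral UNIV (\<lambda>x. \<bar>- g x\<bar> * f (g x)) = Gamma z"
    using f_int by (subst has_absolute_integral_change_of_variables_1') (auto simp: integral_unique)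
  moreover have "\<bar>- g x\<bar> * f (g x) = m powr z * (exp (- z * x) * exp (- m * exp (- x)))" for x
  proof -
    have "\<bar>- g x\<bar> * f (g x) = (g x powr 1 * g x powr (z - 1)) / exp (g x)"
      using m by (simp add: f_def g_def)
    also have "\<dots> = g x powr z * exp (- g x)"
      unfolding powr_add[symmetric] by (simp add: exp_minus divide_inverse)
    also have "g x powr z = m powr z * exp (- z * x)"
      using m by (simp add: g_def powr_mult) (simp add: powr_def)
    finally show ?thesis
      by (simp add: g_def)
  qed
  ultimately have int: "set_integrable lebesgue UNIV (\<lambda>x. m powr z * (exp (- z * x) * exp (- m * exp (- x))))"
    and eq: "integral UNIV (\<lambda>x. m powr z * (exp (- z * x) * exp (- m * exp (- x)))) = Gamma z"
    by auto
  have "has_bochner_integral lebesgue (\<lambda>x. m powr z * (exp (- z * x) * exp (- m * exp (- x)))) (Gamma z)"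
    using int set_lebesgue_integral_eq_integral(2)[OF int] eq m
    by (simp add: has_bochner_integral_iff set_integrable_def set_lebesgue_integral_def)
  from has_bochner_integral_mult_right[OF this, of "m powr (- z)"] show ?thesis
    using m by (simp add: powr_minus field_simps)
qed

lemma has_bochner_integral_exp_atLeast_0:
  assumes "e > (0::real)"
  shows "has_bochner_integral lebesgue (\<lambda>x. indicator {0..} x * exp (- e * x)) (1 / e)"
proof -
  have *: "((\<lambda>x. exp (- e * x)) has_integral (1 / e)) {0..}"
    using has_integral_exp_minus_to_infinity[OF assms, of 0] by simp
  then have int: "set_integrable lebesgue {0..} (\<lambda>x. exp (- e * x))"
    by (intro nonnegative_absolutely_integrable_1) (auto simp: integrable_on_def)
  show ?thesis
    using int set_lebesgue_integral_eq_integral(2)[OF int] integral_unique[OF *]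
    by (simp add: has_bochner_integral_iff set_integrable_def set_lebesgue_integral_def)
qed

text \<open>Reduction to the exchange theorem for sequences: \<open>E\<close> is encoded in the
  natural numbers, with zero functions outside the set \<open>N\<close> of codes.\<close>

lemma has_bochner_integral_infsum:
  fixes f :: "'i \<Rightarrow> 'x \<Rightarrow> 'b::{banach, second_countable_topology}"
  assumes E: "countable E" and int: "\<And>i. i \<in> E \<Longrightarrow> integrable M (f i)"
    and pointwise: "\<And>x. (\<lambda>i. norm (f i x)) summable_on E"
    and total: "(\<lambda>i. \<integral>x. norm (f i x) \<partial>M) summable_on E"
  shows "has_bochner_integral M (\<lambda>x. \<Sum>\<^sub>\<infinity>i\<in>E. f i x) (\<Sum>\<^sub>\<infinity>i\<in>E. integral\<^sup>L M (f i))"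
proof -
  define N where "N = to_nat_on E ` E"
  define j where "j = from_nat_into E"
  have bij: "bij_betw j N E"
    unfolding N_def j_def using E
    by (intro bij_betwI[of _ _ _ "to_nat_on E"]) auto
  have sums: "(\<lambda>n. if n \<in> N then h (j n) else 0) sums (\<Sum>\<^sub>\<infinity>i\<in>E. h i)"
    if "h summable_on E" for h :: "'i \<Rightarrow> 'c::banach"
  proof -
    have "((\<lambda>n. h (j n)) has_sum (\<Sum>\<^sub>\<infinity>i\<in>E. h i)) N"
      using that by (subst has_sum_reindex_bij_betw[OF bij]) simp
    then have "((\<lambda>n. if n \<in> N then h (j n) else 0) has_sum (\<Sum>\<^sub>\<infinity>i\<in>E. h i)) UNIV"
      by (rule has_sum_cong_neutral[THEN iffD1, rotated -1]) auto
    then show ?thesis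
      by (rule has_sum_imp_sums)
  qed
  define F where "F n = (if n \<in> N then f (j n) else (\<lambda>x. 0))" for n
  have F_int: "integrable M (F n)" for n
    using int bij by (auto simp: F_def bij_betw_def)
  have F_norm: "summable (\<lambda>n. norm (F n x))" for x
  proof -
    have "(\<lambda>n. norm (F n x)) = (\<lambda>n. if n \<in> N then norm (f (j n) x) else 0)"
      by (auto simp: F_def)
    then show ?thesis
      using sums[OF pointwise, of x] sums_summable by metis
  qed
  have F_total: "summable (\<lambda>n. \<integral>x. norm (F n x) \<partial>M)"
  proof -
    have "(\<lambda>n. \<integral>x. norm (F n x) \<partial>M) = (\<lambda>n. if n \<in> N then \<integral>x. norm (f (j n) x) \<partial>M else 0)"
      by (auto simp: F_def)
    then show ?thesis
      using sums[OF total] sums_summable by metis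
  qed
  have F_suminf: "(\<Sum>n. F n x) = (\<Sum>\<^sub>\<infinity>i\<in>E. f i x)" for x
  proof -
    have "(\<lambda>n. F n x) = (\<lambda>n. if n \<in> N then f (j n) x else 0)"
      by (auto simp: F_def)
    then show ?thesis
      using sums[OF Infinite_Sum.abs_summable_summable[OF pointwise], of x] sums_unique by metis
  qed
  have F_integral: "(\<Sum>n. integral\<^sup>L M (F n)) = (\<Sum>\<^sub>\<infinity>i\<in>E. integral\<^sup>L M (f i))"
  proof -
    have "(\<lambda>i. norm (integral\<^sup>L M (f i))) summable_on E"
      using total by (rule Infinite_Sum.abs_summable_on_comparison_test') simp
    note sums[OF Infinite_Sum.abs_summable_summable[OF this]]
    moreover have "(\<lambda>n. integral\<^sup>L M (F n)) = (\<lambda>n. if n \<in> N then integral\<^sup>L M (f (j n)) else 0)"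
      by (auto simp: F_def)
    ultimately show ?thesis
      using sums_unique by metis
  qed
  show ?thesis
    using integrable_suminf[OF F_int AE_I2[OF F_norm] F_total]
      integral_suminf[OF F_int AE_I2[OF F_norm] F_total]
    by (simp add: has_bochner_integral_iff F_suminf F_integral)
qed

text \<open>An Abelian theorem: after multiplication by \<open>\<epsilon>\<close> only the behaviour
  of \<open>r\<close> at infinity counts. The part beyond \<open>X\<close> contributes at most
  \<open>e / 2\<close>, while \<open>{0..X}\<close> and the negative axis contribute a multiple of
  \<open>\<epsilon>\<close>.\<close>

lemma abelian_vanishing:
  fixes r :: "real \<Rightarrow> 'b::{banach, second_countable_topology}"
  assumes int: "\<And>\<epsilon>. \<epsilon> > 0 \<Longrightarrow> integrable lebesgue (\<lambda>x. exp (- \<epsilon> * x) *\<^sub>R r x)"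
    and lim: "(r \<longlongrightarrow> 0) at_top"
    and B: "\<And>x. x \<ge> 0 \<Longrightarrow> norm (r x) \<le> B"
    and C: "\<And>x. x < 0 \<Longrightarrow> norm (r x) \<le> C * exp (- \<kappa> * exp (- x))" "\<kappa> > 0" "C \<ge> 0"
  shows "((\<lambda>\<epsilon>. \<epsilon> *\<^sub>R (LINT x|lebesgue. exp (- \<epsilon> * x) *\<^sub>R r x)) \<longlongrightarrow> 0) (at_right 0)"
proof (rule tendstoI)
  fix e :: real assume e: "e > 0"
  then have "\<forall>\<^sub>F x in at_top. norm (r x) < e / 2"
    using lim by (auto simp: tendsto_iff dest: spec[of _ "e / 2"])
  then obtain X0 where X0: "\<And>x. x \<ge> X0 \<Longrightarrow> norm (r x) < e / 2"
    by (auto simp: eventually_at_top_linorder)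
  define X where "X = max 0 X0"
  have "B \<ge> 0"
    using B[of 0] norm_ge_zero[of "r 0"] by linarith
  \<comment> \<open>\<open>B * X\<close> bounds the integral over \<open>{0..X}\<close>, and
    \<open>C / \<kappa>\<close>, which is \<open>C * (Gamma 1 * \<kappa> powr (- 1))\<close>, the
    one over the negative axis.\<close>
  define Z where "Z = B * X + C / \<kappa>"
  have "Z \<ge> 0"
    using \<open>B \<ge> 0\<close> C by (simp add: Z_def X_def)
  have bound: "norm (\<epsilon> *\<^sub>R (LINT x|lebesgue. exp (- \<epsilon> * x) *\<^sub>R r x)) \<le> e / 2 + \<epsilon> * Z"
    if \<epsilon>: "0 < \<epsilon>" "\<epsilon> \<le> 1" for \<epsilon>
  proof -
    \<comment> \<open>The last summand serves the negative axis: there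
      \<open>exp (- \<epsilon> * x) \<le> exp (- 1 * x)\<close> for
      \<open>\<epsilon> \<le> 1\<close>, which makes its contribution independent of
      \<open>\<epsilon>\<close>.\<close>
    define w where "w x = e / 2 * (indicator {0..} x * exp (- \<epsilon> * x)) + B * indicator {0..X} x
        + C * (exp (- 1 * x) * exp (- \<kappa> * exp (- x)))" for x
    have "has_bochner_integral lebesgue (indicator {0..X}) X"
      using has_bochner_integral_real_indicator[of "{0..X}" lebesgue] by (simp add: X_def)
    then have w: "has_bochner_integral lebesgue w
        (e / 2 * (1 / \<epsilon>) + B * X + C * (Gamma 1 * \<kappa> powr (- 1)))"
      unfolding w_def
      by (intro has_bochner_integral_add has_bochner_integral_mult_right
          has_bochner_integral_exp_atLeast_0 has_bochner_integral_Gamma_exp \<epsilon> C(2)) auto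
    have le: "norm (exp (- \<epsilon> * x) *\<^sub>R r x) \<le> w x" for x
    proof (cases "x < 0")
      case True
      have "exp (- \<epsilon> * x) * norm (r x) \<le> exp (- 1 * x) * (C * exp (- \<kappa> * exp (- x)))"
        using True \<epsilon> C(1)[OF True] by (intro mult_mono) auto
      with True show ?thesis
        by (simp add: w_def algebra_simps)
    next
      case False
      have "C * (exp (- 1 * x) * exp (- \<kappa> * exp (- x))) \<ge> 0"
        using C(3) by simp
      moreover have "exp (- \<epsilon> * x) * norm (r x) \<le>
          e / 2 * (indicator {0..} x * exp (- \<epsilon> * x)) + B * indicator {0..X} x"
      proof (cases "x \<le> X")
        case True
        have "exp (- \<epsilon> * x) * norm (r x) \<le> 1 * B"
          using False \<epsilon> B[of x] by (intro mult_mono) auto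
        with True False e show ?thesis
          by (auto intro: order_trans[of _ B])
      next
        case False
        then have "exp (- \<epsilon> * x) * norm (r x) \<le> exp (- \<epsilon> * x) * (e / 2)"
          using less_imp_le[OF X0[of x]] by (intro mult_left_mono) (auto simp: X_def)
        with False \<open>\<not> x < 0\<close> show ?thesis
          by simp
      qed
      ultimately show ?thesis
        by (simp add: w_def)
    qed
    have "norm (LINT x|lebesgue. exp (- \<epsilon> * x) *\<^sub>R r x) \<le> (LINT x|lebesgue. w x)"
      by (intro order_trans[OF integral_norm_bound integral_mono] le integrable_norm int \<epsilon>
          integrable.intros[OF w])
    also have "\<dots> = e / 2 / \<epsilon> + Z"
      using w C(2) by (simp add: has_bochner_integral_iff Z_def powr_minus field_simps)
    finally have "\<epsilon> * norm (LINT x|lebesgue. exp (- \<epsilon> * x) *\<^sub>R r x) \<le> \<epsilon> * (e / 2 / \<epsilon> + Z)"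
      using \<epsilon> by (intro mult_left_mono) auto
    then show ?thesis
      using \<epsilon> by (simp add: distrib_left)
  qed
  have "\<forall>\<^sub>F \<epsilon> in at_right 0. \<epsilon> < min 1 (e / 2 / (Z + 1))"
    using e \<open>Z \<ge> 0\<close> by (intro order_tendstoD(2)[OF tendsto_ident_at]) auto
  then show "\<forall>\<^sub>F \<epsilon> in at_right 0. dist (\<epsilon> *\<^sub>R (LINT x|lebesgue. exp (- \<epsilon> * x) *\<^sub>R r x)) 0 < e"
    using eventually_at_right_less[of "0::real"]
  proof eventually_elim
    case (elim \<epsilon>)
    then have "\<epsilon> * (Z + 1) < e / 2"
      using \<open>Z \<ge> 0\<close> by (simp add: pos_less_divide_eq algebra_simps)
    then show ?case
      using bound[of \<epsilon>] elim by (simp add: distrib_left)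
  qed
qed

text \<open>Measurability on the half-line follows from local integrability through truncations to
  \<open>{0..real n}\<close>; boundedness supplies the integrable majorant.\<close>

lemma integrable_laplace:
  fixes g :: "real \<Rightarrow> 'b::{banach, second_countable_topology, euclidean_space}"
  assumes bdd: "\<And>x. x \<ge> 0 \<Longrightarrow> norm (g x) \<le> G" and loc: "\<And>b. g absolutely_integrable_on {0..b}"
    and "\<epsilon> > 0"
  shows "integrable lebesgue (\<lambda>x. exp (- \<epsilon> * x) *\<^sub>R (indicator {0..} x *\<^sub>R g x))"
proof (rule Bochner_Integration.integrable_bound)
  have "(\<lambda>x. indicator {0..real n} x *\<^sub>R g x) \<in> borel_measurable lebesgue" for n
    using loc[of n] by (simp add: set_integrable_def borel_measurable_integrable)
  then have "(\<lambda>x. indicator {0..} x *\<^sub>R g x) \<in> borel_measurable lebesgue"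
  proof (rule borel_measurable_LIMSEQ_metric)
    fix x :: real
    obtain m where m: "x \<le> real m"
      using real_arch_simple by blast
    have "\<forall>\<^sub>F n in sequentially. indicator {0..real n} x *\<^sub>R g x = indicator {0..} x *\<^sub>R g x"
      using eventually_ge_at_top[of m] by eventually_elim (use m in \<open>auto simp: indicator_def\<close>)
    then show "(\<lambda>n. indicator {0..real n} x *\<^sub>R g x) \<longlonglongrightarrow> indicator {0..} x *\<^sub>R g x"
      by (rule tendsto_eventually)
  qed
  moreover have "(\<lambda>x::real. exp (- \<epsilon> * x)) \<in> borel_measurable lebesgue"
    by (intro measurable_completion) simp
  ultimately show "(\<lambda>x. exp (- \<epsilon> * x) *\<^sub>R (indicator {0..} x *\<^sub>R g x)) \<in> borel_measurable lebesgue"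
    by (rule borel_measurable_scaleR[rotated])
  show "integrable lebesgue (\<lambda>x. G * (indicator {0..} x * exp (- \<epsilon> * x)))"
    using has_bochner_integral_exp_atLeast_0[OF assms(3)]
    by (intro integrable_mult_right) (auto simp: has_bochner_integral_iff)
  show "AE x in lebesgue. norm (exp (- \<epsilon> * x) *\<^sub>R (indicator {0..} x *\<^sub>R g x)) \<le>
      norm (G * (indicator {0..} x * exp (- \<epsilon> * x)))"
  proof (rule AE_I2)
    show "norm (exp (- \<epsilon> * x) *\<^sub>R (indicator {0..} x *\<^sub>R g x)) \<le>
      norm (G * (indicator {0..} x * exp (- \<epsilon> * x)))" for x
      using order_trans[OF bdd[of x] abs_ge_self] by (auto simp: indicator_def abs_mult)
  qed
qed

lemma laplace_eq:
  "laplace g \<epsilon> = (LINT x|lebesgue. exp (- \<epsilon> * x) *\<^sub>R (indicator {0..} x *\<^sub>R g x))"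
  by (simp add: laplace_def set_lebesgue_integral_def mult.commute)

lemma laplace_of_real:
  "laplace (\<lambda>x. complex_of_real (f x)) s = of_real (laplace f s)"
  unfolding laplace_eq integral_complex_of_real[symmetric]
  by (simp add: scaleR_conv_of_real)

section \<open>Theta series and Dirichlet series\<close>

text \<open>To be applied to the squares of the eigenvalues of \<open>D\<close>; the gap
  \<open>\<kappa>\<close> then comes from invertibility and yields exponential decay for large
  \<open>t\<close>.\<close>

locale theta_series =
  fixes E :: "'i set" and \<mu> :: "'i \<Rightarrow> real" and \<kappa> :: real
  assumes gap: "\<kappa> > 0" "\<And>e. e \<in> E \<Longrightarrow> \<kappa> \<le> \<mu> e"
    and theta_summable: "\<And>t. t > 0 \<Longrightarrow> (\<lambda>e. exp (- t * \<mu> e)) summable_on E"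
begin

lemma \<mu>_pos: "e \<in> E \<Longrightarrow> \<mu> e > 0"
  using gap by (metis less_le_trans)

definition theta :: "real \<Rightarrow> real" where
  "theta t = (\<Sum>\<^sub>\<infinity>e\<in>E. exp (- t * \<mu> e))"

text \<open>The weights \<open>b e\<close> will be the diagonal entries
  \<open>cinner e (A e)\<close>, or constantly 1 for the heat trace itself.\<close>

definition Theta :: "('i \<Rightarrow> complex) \<Rightarrow> real \<Rightarrow> complex" where
  "Theta b t = (\<Sum>\<^sub>\<infinity>e\<in>E. of_real (exp (- t * \<mu> e)) * b e)"

text \<open>The exponent refers to the square of an eigenvalue: \<open>Zeta b z\<close> corresponds
  to the power \<open>- 2 * z\<close> of the absolute value of \<open>D\<close>.\<close>

definition Zeta :: "('i \<Rightarrow> complex) \<Rightarrow> real \<Rightarrow> complex" where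
  "Zeta b z = (\<Sum>\<^sub>\<infinity>e\<in>E. of_real (\<mu> e powr - z) * b e)"

section \<open>Convergence and growth of theta series\<close>

lemma theta_nonneg: "theta t \<ge> 0"
  unfolding theta_def by (intro infsum_nonneg) simp

lemma countable_index: "countable E"
  using summable_countable_real[OF theta_summable[OF zero_less_one]] by simp

lemma Theta_one:
  assumes "t > 0"
  shows "Theta (\<lambda>_. 1) t = of_real (theta t)"
  unfolding Theta_def theta_def mult_1_right
  by (intro infsumI has_sum_of_real has_sum_infsum theta_summable assms)

lemma Theta_bound:
  assumes "\<And>e. e \<in> E \<Longrightarrow> cmod (b e) \<le> M" "t > 0"
  shows "(\<lambda>e. cmod (of_real (exp (- t * \<mu> e)) * b e)) summable_on E"
    and "cmod (Theta b t) \<le> M * theta t"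
proof -
  have M: "((\<lambda>e. M * exp (- t * \<mu> e)) has_sum M * theta t) E"
    unfolding theta_def by (intro has_sum_cmult_right has_sum_infsum theta_summable assms)
  have le: "cmod (of_real (exp (- t * \<mu> e)) * b e) \<le> M * exp (- t * \<mu> e)" if "e \<in> E" for e
    using assms(1)[OF that] by (simp add: norm_mult mult.commute)
  show s: "(\<lambda>e. cmod (of_real (exp (- t * \<mu> e)) * b e)) summable_on E"
    using has_sum_imp_summable[OF M] by (rule summable_on_comparison_test) (use le in auto)
  have "cmod (Theta b t) \<le> (\<Sum>\<^sub>\<infinity>e\<in>E. cmod (of_real (exp (- t * \<mu> e)) * b e))"
    unfolding Theta_def by (rule norm_infsum_bound[OF s])
  also have "\<dots> \<le> M * theta t"
    by (rule has_sum_mono[OF has_sum_infsum[OF s] M]) (rule le)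
  finally show "cmod (Theta b t) \<le> M * theta t" .
qed

lemma theta_decay:
  assumes "0 < t0" "t0 \<le> t"
  shows "theta t \<le> exp (- (t - t0) * \<kappa>) * theta t0"
  unfolding theta_def
proof (rule has_sum_mono)
  show "((\<lambda>e. exp (- t * \<mu> e)) has_sum (\<Sum>\<^sub>\<infinity>e\<in>E. exp (- t * \<mu> e))) E"
    using assms by (intro has_sum_infsum theta_summable) simp
  show "((\<lambda>e. exp (- (t - t0) * \<kappa>) * exp (- t0 * \<mu> e)) has_sum
      exp (- (t - t0) * \<kappa>) * (\<Sum>\<^sub>\<infinity>e\<in>E. exp (- t0 * \<mu> e))) E"
    using assms by (intro has_sum_cmult_right has_sum_infsum theta_summable) simp
  show "exp (- t * \<mu> e) \<le> exp (- (t - t0) * \<kappa>) * exp (- t0 * \<mu> e)" if "e \<in> E" for e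
  proof -
    have "(t - t0) * \<kappa> \<le> (t - t0) * \<mu> e"
      using assms gap(2)[OF that] by (intro mult_left_mono) auto
    then show ?thesis
      by (simp add: exp_add[symmetric] algebra_simps)
  qed
qed

text \<open>A power bound near 0 is combined with exponential decay at infinity. Half of the decay
  rate is spent on absorbing the factor \<open>t powr a\<close>, so that \<open>\<kappa> / 2\<close>
  remains.\<close>

lemma theta_global_bound:
  assumes a: "a > 0" and t0: "t0 > 0" and C0: "\<And>t. 0 < t \<Longrightarrow> t \<le> t0 \<Longrightarrow> theta t \<le> C0 * t powr (- a)"
  obtains C where "C \<ge> 0" "\<And>t. t > 0 \<Longrightarrow> theta t \<le> C * (t powr (- a) * exp (- (\<kappa> / 2) * t))"
proof -
  define K where "K = (2 / \<kappa>) powr a * a powr a"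
  have K: "t powr a * exp (- (\<kappa> / 2) * t) \<le> K" if "t > 0" for t
  proof -
    have "(\<kappa> / 2 * t) powr a \<le> a powr a * exp (\<kappa> / 2 * t)"
      using gap(1) that a by (intro powr_le_exp) auto
    then have "(2 / \<kappa>) powr a * (\<kappa> / 2 * t) powr a \<le> (2 / \<kappa>) powr a * (a powr a * exp (\<kappa> / 2 * t))"
      by (intro mult_left_mono) auto
    also have "(2 / \<kappa>) powr a * (\<kappa> / 2 * t) powr a = t powr a"
      using gap(1) that by (simp add: powr_mult[symmetric])
    finally have "t powr a \<le> K * exp (\<kappa> / 2 * t)"
      by (simp add: K_def mult.assoc)
    then have "t powr a * exp (- (\<kappa> / 2) * t) \<le> K * exp (\<kappa> / 2 * t) * exp (- (\<kappa> / 2) * t)"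
      by (intro mult_right_mono) auto
    also have "\<dots> = K"
      by (simp add: mult.assoc exp_add[symmetric])
    finally show ?thesis .
  qed
  \<comment> \<open>\<open>C1\<close> serves \<open>t \<le> t0\<close>, where the exponential is
    bounded below; \<open>C2\<close> serves \<open>t > t0\<close>, where \<open>theta_decay\<close>
    applies.\<close>
  define C1 where "C1 = \<bar>C0\<bar> * exp (\<kappa> / 2 * t0)"
  define C2 where "C2 = exp (t0 * \<kappa>) * theta t0 * K"
  have "K \<ge> 0"
    by (simp add: K_def)
  then have C12: "C1 \<ge> 0" "C2 \<ge> 0"
    by (simp_all add: C1_def C2_def theta_nonneg)
  show thesis
  proof (rule that[of "C1 + C2"])
    fix t :: real assume t: "t > 0"
    let ?k = "t powr (- a) * exp (- (\<kappa> / 2) * t)"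
    have k: "?k \<ge> 0" by simp
    show "theta t \<le> (C1 + C2) * ?k"
    proof (cases "t \<le> t0")
      case True
      have "theta t \<le> \<bar>C0\<bar> * t powr (- a)"
        using C0[OF t True] by (rule order_trans) (simp add: mult_right_mono)
      also have "\<dots> \<le> \<bar>C0\<bar> * t powr (- a) * exp (\<kappa> / 2 * (t0 - t))"
        using True gap(1) mult_left_mono[of 1 "exp (\<kappa> / 2 * (t0 - t))" "\<bar>C0\<bar> * t powr (- a)"]
        by simp
      also have "exp (\<kappa> / 2 * (t0 - t)) = exp (\<kappa> / 2 * t0) * exp (- (\<kappa> / 2) * t)"
        by (simp add: exp_add[symmetric] field_simps)
      also have "\<bar>C0\<bar> * t powr (- a) * \<dots> = C1 * ?k"
        by (simp add: C1_def)
      also have "\<dots> \<le> (C1 + C2) * ?k"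
        using C12 k by (intro mult_right_mono) auto
      finally show ?thesis .
    next
      case False
      have "theta t \<le> exp (- (t - t0) * \<kappa>) * theta t0"
        using False t0 by (intro theta_decay) auto
      also have "exp (- (t - t0) * \<kappa>) = exp (t0 * \<kappa>) * exp (- (\<kappa> / 2) * t) * exp (- (\<kappa> / 2) * t)"
        by (simp add: exp_add[symmetric] field_simps)
      also have "\<dots> = exp (t0 * \<kappa>) * ((t powr a * exp (- (\<kappa> / 2) * t)) * ?k)"
        using t by (simp add: powr_minus field_simps)
      also have "\<dots> * theta t0 \<le> exp (t0 * \<kappa>) * (K * ?k) * theta t0"
        using K[OF t] by (intro mult_left_mono mult_right_mono theta_nonneg) auto
      also have "\<dots> = C2 * ?k"
        by (simp add: C2_def)
      also have "\<dots> \<le> (C1 + C2) * ?k"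
        using C12 k by (intro mult_right_mono) auto
      finally show ?thesis .
    qed
  qed (use C12 in simp)
qed

text \<open>Up to the factor \<open>Gamma z\<close>, a partial sum is the Mellin integral of a
  partial sum of \<open>theta\<close>; the bound on \<open>theta\<close> leaves a Gamma integral
  that converges for \<open>z > a\<close>.\<close>

lemma dirichlet_summable:
  assumes "a > 0" "\<And>t. t > 0 \<Longrightarrow> theta t \<le> C * (t powr (- a) * exp (- (\<kappa> / 2) * t))" "z > a"
  shows "(\<lambda>e. \<mu> e powr - z) summable_on E"
proof (rule nonneg_bdd_above_summable_on)
  let ?B = "C * (Gamma (z - a) * (\<kappa> / 2) powr - (z - a))"
  show "bdd_above (sum (\<lambda>e. \<mu> e powr - z) ` {F. F \<subseteq> E \<and> finite F})"
  proof (rule bdd_aboveI2)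
    fix F assume "F \<in> {F. F \<subseteq> E \<and> finite F}"
    then have F: "F \<subseteq> E" "finite F" by auto
    have z: "z > 0" using assms by linarith
    have L: "has_bochner_integral lebesgue (\<lambda>x. \<Sum>e\<in>F. exp (- z * x) * exp (- \<mu> e * exp (- x)))
        (\<Sum>e\<in>F. Gamma z * \<mu> e powr (- z))"
      using F \<mu>_pos z by (intro has_bochner_integral_sum has_bochner_integral_Gamma_exp) auto
    have R: "has_bochner_integral lebesgue (\<lambda>x. C * (exp (- (z - a) * x) * exp (- (\<kappa> / 2) * exp (- x)))) ?B"
      using assms gap by (intro has_bochner_integral_mult_right has_bochner_integral_Gamma_exp) auto
    have "(\<Sum>e\<in>F. exp (- z * x) * exp (- \<mu> e * exp (- x))) \<le>
        C * (exp (- (z - a) * x) * exp (- (\<kappa> / 2) * exp (- x)))" for x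
    proof -
      have "(\<Sum>e\<in>F. exp (- exp (- x) * \<mu> e)) \<le> theta (exp (- x))"
        unfolding theta_def using F by (intro finite_sum_le_infsum theta_summable) auto
      also have "\<dots> \<le> C * (exp (- x) powr (- a) * exp (- (\<kappa> / 2) * exp (- x)))"
        by (rule assms(2)) simp
      also have "exp (- x) powr (- a) = exp (a * x)"
        by (simp add: powr_def)
      finally have "exp (- z * x) * (\<Sum>e\<in>F. exp (- exp (- x) * \<mu> e)) \<le>
          exp (- z * x) * (C * (exp (a * x) * exp (- (\<kappa> / 2) * exp (- x))))"
        by (intro mult_left_mono) auto
      also have "\<dots> = C * ((exp (- z * x) * exp (a * x)) * exp (- (\<kappa> / 2) * exp (- x)))"
        by (simp add: mult_ac)
      also have "exp (- z * x) * exp (a * x) = exp (- (z - a) * x)"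
        by (simp add: exp_add[symmetric] algebra_simps)
      finally show ?thesis
        by (simp add: sum_distrib_left mult.commute)
    qed
    then have "(\<Sum>e\<in>F. Gamma z * \<mu> e powr (- z)) \<le> ?B"
      using has_bochner_integral_integral_eq[OF L] has_bochner_integral_integral_eq[OF R]
        integral_mono[OF integrable.intros[OF L] integrable.intros[OF R]]
      by metis
    then show "(\<Sum>e\<in>F. \<mu> e powr - z) \<le> ?B / Gamma z"
      using Gamma_real_pos[OF z] by (simp add: sum_distrib_left[symmetric] pos_le_divide_eq mult.commute)
  qed
qed simp

text \<open>Each term is a Gamma integral; sum and integral may be exchanged because the integrals
  of the norms are at most \<open>Gamma z * \<mu> e powr - z * M\<close>, which is summable.\<close>

lemma mellin:
  assumes b: "\<And>e. e \<in> E \<Longrightarrow> cmod (b e) \<le> M" and z: "z > 0"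
    and summable: "(\<lambda>e. \<mu> e powr - z) summable_on E"
  shows "has_bochner_integral lebesgue (\<lambda>x. exp (- z * x) *\<^sub>R Theta b (exp (- x)))
    (Gamma z *\<^sub>R Zeta b z)"
proof -
  define k where "k e x = exp (- z * x) * exp (- \<mu> e * exp (- x))" for e x
  define h where "h e x = of_real (k e x) * b e" for e x
  have k: "has_bochner_integral lebesgue (k e) (Gamma z * \<mu> e powr - z)" if "e \<in> E" for e
    unfolding k_def using \<mu>_pos[OF that] z by (intro has_bochner_integral_Gamma_exp) auto
  have h: "has_bochner_integral lebesgue (h e) (of_real (Gamma z * \<mu> e powr - z) * b e)"
    if "e \<in> E" for e
    unfolding h_def by (intro has_bochner_integral_mult_left has_bochner_integral_of_real k that)
  have norm_h: "norm (h e x) = k e x * cmod (b e)" for e x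
    by (simp add: h_def k_def norm_mult)
  have h_eq: "h e x = exp (- z * x) *\<^sub>R (of_real (exp (- exp (- x) * \<mu> e)) * b e)" for e x
    by (simp add: h_def k_def scaleR_conv_of_real mult.commute)
  have infsum_h: "(\<Sum>\<^sub>\<infinity>e\<in>E. h e x) = exp (- z * x) *\<^sub>R Theta b (exp (- x))" for x
    unfolding h_eq Theta_def by (rule infsum_scaleR_right)
  have "has_bochner_integral lebesgue (\<lambda>x. \<Sum>\<^sub>\<infinity>e\<in>E. h e x) (\<Sum>\<^sub>\<infinity>e\<in>E. integral\<^sup>L lebesgue (h e))"
  proof (rule has_bochner_integral_infsum[OF countable_index])
    show "integrable lebesgue (h e)" if "e \<in> E" for e
      using h[OF that] by (rule integrable.intros)
    show "(\<lambda>e. norm (h e x)) summable_on E" for x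
      unfolding h_eq norm_scaleR by (intro summable_on_cmult_right Theta_bound(1)[OF b]) auto
    have "(\<lambda>e. \<integral>x. norm (h e x) \<partial>lebesgue) summable_on E \<longleftrightarrow>
        (\<lambda>e. Gamma z * \<mu> e powr - z * cmod (b e)) summable_on E"
      unfolding norm_h
      by (intro summable_on_cong has_bochner_integral_integral_eq has_bochner_integral_mult_left k)
    moreover have "(\<lambda>e. Gamma z * \<mu> e powr - z * cmod (b e)) summable_on E"
    proof (rule summable_on_comparison_test)
      show "(\<lambda>e. Gamma z * \<mu> e powr - z * M) summable_on E"
        by (intro summable_on_cmult_left summable_on_cmult_right summable)
    qed (use b Gamma_real_pos[OF z] in \<open>auto intro!: mult_left_mono\<close>)
    ultimately show "(\<lambda>e. \<integral>x. norm (h e x) \<partial>lebesgue) summable_on E"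
      by blast
  qed
  moreover have "(\<Sum>\<^sub>\<infinity>e\<in>E. integral\<^sup>L lebesgue (h e)) = Gamma z *\<^sub>R Zeta b z"
  proof -
    have "(\<Sum>\<^sub>\<infinity>e\<in>E. integral\<^sup>L lebesgue (h e)) =
        (\<Sum>\<^sub>\<infinity>e\<in>E. Gamma z *\<^sub>R (of_real (\<mu> e powr - z) * b e))"
      using has_bochner_integral_integral_eq[OF h]
      by (intro infsum_cong) (simp add: scaleR_conv_of_real mult.assoc)
    also have "\<dots> = Gamma z *\<^sub>R Zeta b z"
      unfolding Zeta_def by (rule infsum_scaleR_right)
    finally show ?thesis .
  qed
  ultimately show ?thesis
    by (simp add: infsum_h)
qed

text \<open>On the scale \<open>t = exp (- x)\<close> the relative error becomes an absolute one,
  because \<open>g\<close> is bounded.\<close>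

lemma Theta_log_limit:
  fixes g :: "real \<Rightarrow> complex"
  assumes g: "\<And>x. x \<ge> 0 \<Longrightarrow> cmod (g x) \<le> G"
    and asymp: "(\<lambda>t. Theta b t - g (- ln t) * of_real (t powr - a))
      \<in> o[at_right 0](\<lambda>t. g (- ln t) * of_real (t powr - a))"
  shows "((\<lambda>x. exp (- a * x) *\<^sub>R Theta b (exp (- x)) - g x) \<longlongrightarrow> 0) at_top"
proof (rule tendstoI)
  fix e :: real assume e: "e > 0"
  have "G \<ge> 0"
    using g[of 0] norm_ge_zero[of "g 0"] by linarith
  define c where "c = e / (2 * (G + 1))"
  have c: "c > 0" "c * G < e"
    using e \<open>G \<ge> 0\<close> by (auto simp: c_def divide_simps)
  have "filterlim (\<lambda>x::real. exp (- x)) (at_right 0) at_top"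
    by (auto simp: filterlim_at intro: filterlim_compose[OF exp_at_bot filterlim_uminus_at_bot_at_top])
  from eventually_compose_filterlim[OF landau_o.smallD[OF asymp c(1)] this]
  show "\<forall>\<^sub>F x in at_top. dist (exp (- a * x) *\<^sub>R Theta b (exp (- x)) - g x) 0 < e"
    using eventually_ge_at_top[of 0]
  proof eventually_elim
    case (elim x)
    have p: "exp (- x) powr - a = exp (a * x)"
      by (simp add: powr_def)
    have "exp (- a * x) *\<^sub>R (g x * of_real (exp (a * x))) = (exp (- a * x) * exp (a * x)) *\<^sub>R g x"
      by (simp only: scaleR_conv_of_real of_real_mult mult_ac)
    also have "exp (- a * x) * exp (a * x) = 1"
      by (simp add: exp_add[symmetric])
    finally have "exp (- a * x) *\<^sub>R Theta b (exp (- x)) - g x =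
        exp (- a * x) *\<^sub>R (Theta b (exp (- x)) - g x * of_real (exp (a * x)))"
      by (simp add: scaleR_diff_right)
    also have "cmod \<dots> \<le> exp (- a * x) * (c * cmod (g x * of_real (exp (a * x))))"
      using elim(1) by (simp add: p)
    also have "\<dots> = c * cmod (g x)"
      by (simp add: norm_mult exp_add[symmetric])
    also have "\<dots> \<le> c * G"
      using c(1) g[OF elim(2)] by (intro mult_left_mono) auto
    finally show ?case
      using c(2) by simp
  qed
qed

text \<open>Both terms are integrals of the same exponential, against \<open>k\<close> and against
  \<open>g\<close> cut off at 0. The difference \<open>r\<close> tends to 0 at infinity and decays
  superexponentially to the left, so \<open>abelian_vanishing\<close> applies.\<close>

lemma zeta_laplace_limit:
  fixes g :: "real \<Rightarrow> complex"
  assumes a: "a > 0" and C: "C \<ge> 0" "\<And>t. t > 0 \<Longrightarrow> theta t \<le> C * (t powr (- a) * exp (- (\<kappa> / 2) * t))"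
    and b: "\<And>e. e \<in> E \<Longrightarrow> cmod (b e) \<le> M" "M \<ge> 0"
    and g: "\<And>x. x \<ge> 0 \<Longrightarrow> cmod (g x) \<le> G" "\<And>b. g absolutely_integrable_on {0..b}"
    and asymp: "(\<lambda>t. Theta b t - g (- ln t) * of_real (t powr - a))
      \<in> o[at_right 0](\<lambda>t. g (- ln t) * of_real (t powr - a))"
  shows "((\<lambda>\<epsilon>. \<epsilon> *\<^sub>R (Gamma (\<epsilon> + a) *\<^sub>R Zeta b (\<epsilon> + a)) - \<epsilon> *\<^sub>R laplace g \<epsilon>) \<longlongrightarrow> 0) (at_right 0)"
proof -
  define k where "k x = exp (- a * x) *\<^sub>R Theta b (exp (- x))" for x
  define r where "r x = k x - indicator {0..} x *\<^sub>R g x" for x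
  have k_int: "has_bochner_integral lebesgue (\<lambda>x. exp (- \<epsilon> * x) *\<^sub>R k x)
      (Gamma (\<epsilon> + a) *\<^sub>R Zeta b (\<epsilon> + a))" if "\<epsilon> > 0" for \<epsilon>
  proof -
    have "has_bochner_integral lebesgue (\<lambda>x. exp (- (\<epsilon> + a) * x) *\<^sub>R Theta b (exp (- x)))
        (Gamma (\<epsilon> + a) *\<^sub>R Zeta b (\<epsilon> + a))"
      using a that by (intro mellin[OF b(1)] dirichlet_summable[OF a C(2)]) auto
    then show ?thesis
      by (simp add: k_def exp_add[symmetric] algebra_simps)
  qed
  have g_int: "integrable lebesgue (\<lambda>x. exp (- \<epsilon> * x) *\<^sub>R (indicator {0..} x *\<^sub>R g x))"
    if "\<epsilon> > 0" for \<epsilon>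
    by (rule integrable_laplace[OF g that])
  have r_int: "has_bochner_integral lebesgue (\<lambda>x. exp (- \<epsilon> * x) *\<^sub>R r x)
      (Gamma (\<epsilon> + a) *\<^sub>R Zeta b (\<epsilon> + a) - laplace g \<epsilon>)" if "\<epsilon> > 0" for \<epsilon>
    unfolding r_def scaleR_diff_right laplace_eq
    by (intro has_bochner_integral_diff k_int has_bochner_integral_integrable g_int that)
  \<comment> \<open>This serves twice: as superexponential decay for \<open>x < 0\<close>, and as
    boundedness by \<open>M * C\<close> for \<open>x \<ge> 0\<close>.\<close>
  have k_bound: "cmod (k x) \<le> M * C * exp (- (\<kappa> / 2) * exp (- x))" for x
  proof -
    have "cmod (Theta b (exp (- x))) \<le> M * (C * (exp (- x) powr (- a) * exp (- (\<kappa> / 2) * exp (- x))))"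
      using b(2) by (intro order_trans[OF Theta_bound(2)[OF b(1)]] mult_left_mono C(2)) auto
    also have "exp (- x) powr (- a) = exp (a * x)"
      by (simp add: powr_def)
    finally have "exp (- a * x) * cmod (Theta b (exp (- x))) \<le>
        exp (- a * x) * (M * (C * (exp (a * x) * exp (- (\<kappa> / 2) * exp (- x)))))"
      by (intro mult_left_mono) auto
    also have "\<dots> = (exp (- a * x) * exp (a * x)) * (M * C * exp (- (\<kappa> / 2) * exp (- x)))"
      by (simp add: mult_ac)
    also have "exp (- a * x) * exp (a * x) = 1"
      by (simp add: exp_add[symmetric])
    finally show ?thesis
      by (simp add: k_def)
  qed
  have "((\<lambda>\<epsilon>. \<epsilon> *\<^sub>R (LINT x|lebesgue. exp (- \<epsilon> * x) *\<^sub>R r x)) \<longlongrightarrow> 0) (at_right 0)"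
  proof (rule abelian_vanishing)
    show "integrable lebesgue (\<lambda>x. exp (- \<epsilon> * x) *\<^sub>R r x)" if "\<epsilon> > 0" for \<epsilon>
      using r_int[OF that] by (rule integrable.intros)
    have "\<forall>\<^sub>F x in at_top. k x - g x = r x"
      using eventually_ge_at_top[of "0::real"] by eventually_elim (simp add: r_def)
    with Theta_log_limit[OF g(1) asymp] show "(r \<longlongrightarrow> 0) at_top"
      unfolding k_def[symmetric] by (rule Lim_transform_eventually)
    show "cmod (r x) \<le> M * C + G" if "x \<ge> 0" for x
    proof -
      have "cmod (k x) \<le> M * C"
        using gap(1) b(2) C(1) by (intro order_trans[OF k_bound] mult_right_le_one_le) auto
      then show ?thesis
        using that g(1)[OF that] norm_triangle_ineq4[of "k x" "g x"] by (simp add: r_def)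
    qed
    show "cmod (r x) \<le> M * C * exp (- (\<kappa> / 2) * exp (- x))" if "x < 0" for x
      using k_bound[of x] that by (simp add: r_def)
  qed (use gap b(2) C(1) in auto)
  then show ?thesis
  proof (rule Lim_transform_eventually)
    show "\<forall>\<^sub>F \<epsilon> in at_right 0. \<epsilon> *\<^sub>R (LINT x|lebesgue. exp (- \<epsilon> * x) *\<^sub>R r x) =
        \<epsilon> *\<^sub>R (Gamma (\<epsilon> + a) *\<^sub>R Zeta b (\<epsilon> + a)) - \<epsilon> *\<^sub>R laplace g \<epsilon>"
      using eventually_at_right_less[of "0::real"]
      by eventually_elim (simp only: has_bochner_integral_integral_eq[OF r_int] scaleR_diff_right)
  qed
qed

text \<open>With constant 1 in the little-o, \<open>theta t\<close> is near 0 at most twice the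
  modulus of the leading term; \<open>theta_global_bound\<close> extends this to all
  \<open>t > 0\<close>.\<close>

lemma theta_upper_bound:
  fixes g :: "real \<Rightarrow> complex"
  assumes a: "a > 0" and g: "\<And>x. x \<ge> 0 \<Longrightarrow> cmod (g x) \<le> G"
    and asymp: "(\<lambda>t. Theta (\<lambda>_. 1) t - g (- ln t) * of_real (t powr - a))
      \<in> o[at_right 0](\<lambda>t. g (- ln t) * of_real (t powr - a))"
  obtains C where "C \<ge> 0" "\<And>t. t > 0 \<Longrightarrow> theta t \<le> C * (t powr (- a) * exp (- (\<kappa> / 2) * t))"
proof -
  from landau_o.smallD[OF asymp zero_less_one] obtain t1 where t1: "t1 > 0"
    "\<And>t. 0 < t \<Longrightarrow> t < t1 \<Longrightarrow>
      cmod (Theta (\<lambda>_. 1) t - g (- ln t) * of_real (t powr - a)) \<le> cmod (g (- ln t) * of_real (t powr - a))"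
    by (auto simp: eventually_at_right_field)
  \<comment> \<open>\<open>t0 \<le> 1\<close> ensures \<open>- ln t \<ge> 0\<close>, the range in
    which \<open>g\<close> is known to be bounded.\<close>
  define t0 where "t0 = min 1 (t1 / 2)"
  have t0: "t0 > 0" "t0 \<le> 1" "t0 < t1"
    using t1(1) by (auto simp: t0_def)
  show thesis
  proof (rule theta_global_bound[OF a t0(1)])
    fix t assume t: "0 < t" "t \<le> t0"
    have "theta t = cmod (Theta (\<lambda>_. 1) t)"
      using t by (simp add: Theta_one theta_nonneg)
    also have "\<dots> \<le> 2 * cmod (g (- ln t) * of_real (t powr - a))"
      using t1(2)[of t] t t0 norm_triangle_ineq2[of "Theta (\<lambda>_. 1) t" "g (- ln t) * of_real (t powr - a)"]
      by simp
    also have "\<dots> \<le> 2 * (G * t powr - a)"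
      using t t0 g[of "- ln t"] by (simp add: norm_mult mult_right_mono)
    finally show "theta t \<le> 2 * G * t powr - a"
      by simp
  qed (rule that)
qed

text \<open>Otherwise \<open>theta t = O(t powr - z)\<close>, so that \<open>g\<close> would tend to \<open>0\<close> at \<open>\<infinity>\<close>.\<close>

lemma not_summable_below:
  fixes g :: "real \<Rightarrow> complex"
  assumes z: "0 < z" "z < a"
    and g: "\<And>x. x \<ge> 0 \<Longrightarrow> cmod (g x) \<le> G" "\<And>b. g absolutely_integrable_on {0..b}"
    and asymp: "(\<lambda>t. Theta (\<lambda>_. 1) t - g (- ln t) * of_real (t powr - a))
      \<in> o[at_right 0](\<lambda>t. g (- ln t) * of_real (t powr - a))"
    and nz: "\<not> ((\<lambda>\<epsilon>. \<epsilon> *\<^sub>R laplace g \<epsilon>) \<longlongrightarrow> 0) (at_right 0)"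
  shows "\<not> (\<lambda>e. \<mu> e powr - z) summable_on E"
proof
  assume s: "(\<lambda>e. \<mu> e powr - z) summable_on E"
  define S where "S = (\<Sum>\<^sub>\<infinity>e\<in>E. \<mu> e powr - z)"
  have theta_le: "theta t \<le> z powr z * t powr - z * S" if t: "t > 0" for t
    unfolding theta_def S_def
  proof (rule has_sum_mono)
    show "((\<lambda>e. exp (- t * \<mu> e)) has_sum (\<Sum>\<^sub>\<infinity>e\<in>E. exp (- t * \<mu> e))) E"
      by (intro has_sum_infsum theta_summable t)
    show "((\<lambda>e. z powr z * t powr - z * \<mu> e powr - z) has_sum
        z powr z * t powr - z * (\<Sum>\<^sub>\<infinity>e\<in>E. \<mu> e powr - z)) E"
      by (intro has_sum_cmult_right has_sum_infsum s)
    show "exp (- t * \<mu> e) \<le> z powr z * t powr - z * \<mu> e powr - z" if "e \<in> E" for e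
    proof -
      have "(t * \<mu> e) powr z \<le> z powr z * exp (t * \<mu> e)"
        using t \<mu>_pos[OF that] z by (intro powr_le_exp) auto
      then show ?thesis
        using t \<mu>_pos[OF that] by (simp add: powr_minus powr_mult exp_minus field_simps)
    qed
  qed
  define k where "k x = exp (- a * x) *\<^sub>R Theta (\<lambda>_. 1) (exp (- x))" for x
  have "(k \<longlongrightarrow> 0) at_top"
  proof (rule tendsto_norm_zero_cancel, rule tendsto_sandwich[where f = "\<lambda>_. 0"])
    have "filterlim (\<lambda>x. - (a - z) * x) at_bot at_top"
      using z by (intro filterlim_tendsto_neg_mult_at_bot[OF tendsto_const _ filterlim_ident]) auto
    then have "((\<lambda>x. z powr z * S * exp (- (a - z) * x)) \<longlongrightarrow> z powr z * S * 0) at_top"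
      by (intro tendsto_intros filterlim_compose[OF exp_at_bot])
    then show "((\<lambda>x. z powr z * S * exp (- (a - z) * x)) \<longlongrightarrow> 0) at_top"
      by simp
    show "\<forall>\<^sub>F x in at_top. norm (k x) \<le> z powr z * S * exp (- (a - z) * x)"
    proof (intro always_eventually allI)
      fix x :: real
      have "norm (k x) = exp (- a * x) * theta (exp (- x))"
        by (simp add: k_def Theta_one theta_nonneg)
      also have "\<dots> \<le> exp (- a * x) * (z powr z * exp (- x) powr - z * S)"
        by (intro mult_left_mono theta_le) auto
      also have "exp (- x) powr - z = exp (z * x)"
        by (simp add: powr_def)
      also have "exp (- a * x) * (z powr z * exp (z * x) * S) = z powr z * S * (exp (- a * x) * exp (z * x))"
        by (simp add: mult_ac)
      also have "exp (- a * x) * exp (z * x) = exp (- (a - z) * x)"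
        by (simp add: exp_add[symmetric] algebra_simps)
      finally show "norm (k x) \<le> z powr z * S * exp (- (a - z) * x)" .
    qed
  qed auto
  from tendsto_diff[OF this Theta_log_limit[OF g(1) asymp]]
  have "(g \<longlongrightarrow> 0) at_top"
    by (simp add: k_def)
  moreover have "\<forall>\<^sub>F x in at_top. g x = indicator {0..} x *\<^sub>R g x"
    using eventually_ge_at_top[of "0::real"] by eventually_elim simp
  ultimately have lim: "((\<lambda>x. indicator {0..} x *\<^sub>R g x) \<longlongrightarrow> 0) at_top"
    by (rule Lim_transform_eventually)
  \<comment> \<open>The function cut off at 0 vanishes on the negative axis, whence
    \<open>C = 0\<close> with an arbitrary positive \<open>\<kappa>\<close>.\<close>
  have "((\<lambda>\<epsilon>. \<epsilon> *\<^sub>R laplace g \<epsilon>) \<longlongrightarrow> 0) (at_right 0)"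
    unfolding laplace_eq
    by (rule abelian_vanishing[where B = G and C = 0 and \<kappa> = 1, OF integrable_laplace[OF g] lim])
       (use g(1) in auto)
  with nz show False ..
qed

end

section \<open>The spectral state\<close>

lemma square_powr_half: "(x\<^sup>2) powr (- (s / 2)) = \<bar>x::real\<bar> powr (- s)"
proof (cases "x = 0")
  case False
  then have "x\<^sup>2 = \<bar>x\<bar> powr 2"
    by simp
  then show ?thesis
    by (simp only: powr_powr) simp
qed simp

theorem lemma2p3:
  fixes \<A> :: "('a::chilbert_space \<Rightarrow> 'a) set" and V :: "'a set" and D :: "'a \<Rightarrow> 'a"
    and A :: "'a \<Rightarrow> 'a" and \<alpha> :: real and f :: "real \<Rightarrow> real" and f\<^sub>A :: "real \<Rightarrow> complex"
  assumes "spectral_triple \<A> V D"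
    and "has_compact_inverse V D"
    and "\<And>t. t > 0 \<Longrightarrow> trace_class (heat_op V D t)"
    and "\<alpha> < 0"
    and "bounded (f ` {0..})"
    and "\<And>b. f absolutely_integrable_on {0..b}"
    and "\<exists>c. c \<noteq> 0 \<and> ((\<lambda>s. s * laplace f s) \<longlongrightarrow> c) (at_right 0)"
    and "(\<lambda>t. op_trace (heat_op V D t) - of_real (f (- ln t) * t powr \<alpha>))
           \<in> o[at_right 0](\<lambda>t. of_real (f (- ln t) * t powr \<alpha>))"
    and "bounded_clinear A"
    and "bounded (f\<^sub>A ` {0..})"
    and "\<exists>x\<ge>0. f\<^sub>A x \<noteq> 0"
    and "\<And>b. f\<^sub>A absolutely_integrable_on {0..b}"
    and "\<exists>c. ((\<lambda>s. of_real s * laplace f\<^sub>A s) \<longlongrightarrow> c) (at_right 0)"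
    and "(\<lambda>t. op_trace (heat_op V D t \<circ> A) - f\<^sub>A (- ln t) * of_real (t powr \<alpha>))
           \<in> o[at_right 0](\<lambda>t. f\<^sub>A (- ln t) * of_real (t powr \<alpha>))"
  shows "(\<exists>l. ((\<lambda>s. op_trace (abs_neg_power V D s \<circ> A) / spectral_zeta V D s) \<longlongrightarrow> l)
            (at_right (metric_dimension V D))) \<and>
         ((\<lambda>s. laplace f\<^sub>A s / of_real (laplace f s)) \<longlongrightarrow> spectral_state V D A) (at_right 0)"
proof -

  \<comment> \<open>Reduction to series over an eigenbasis\<close>
  have sa: "self_adjoint_op V D"
    using assms(1) by (simp add: spectral_triple_def)
  obtain E lam \<delta> where E: "is_onb E" "\<And>e. e \<in> E \<Longrightarrow> e \<in> eigenspace V D (lam e)"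
    "\<delta> > 0" "\<And>e. e \<in> E \<Longrightarrow> \<delta> \<le> \<bar>lam e\<bar>"
    using ex_eigenbasis[OF sa assms(2)] by metis
  interpret eigenbasis V D E lam
    by standard (use sa E in auto)
  have lam_nz: "lam e \<noteq> 0" if "e \<in> E" for e
    using E(3) E(4)[OF that] by auto
  interpret theta_series E "\<lambda>e. (lam e)\<^sup>2" "\<delta>\<^sup>2"
  proof
    show "\<delta>\<^sup>2 \<le> (lam e)\<^sup>2" if "e \<in> E" for e
      using E(3) E(4)[OF that] by (metis abs_le_square_iff abs_of_pos)
    show "(\<lambda>e. exp (- t * (lam e)\<^sup>2)) summable_on E" if "t > 0" for t
      using trace_class_fun_calcD[of "\<lambda>l. exp (- t * l\<^sup>2)"] assms(3)[OF that]
      by (simp add: heat_op_def)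
  qed (use E(3) in simp)
  define a where "a = - \<alpha>"
  have a: "a > 0" and \<alpha>: "\<alpha> = - a"
    using assms(4) by (simp_all add: a_def)
  define b where "b e = cinner e (A e)" for e
  define g where "g x = complex_of_real (f x)" for x
  obtain M where M: "\<And>x. norm (A x) \<le> norm x * M" "M > 0"
    using bounded_linear.pos_bounded[OF bounded_clinear_bounded[OF assms(9)]] by blast
  have b: "cmod (b e) \<le> M" if "e \<in> E" for e
    using norm_cinner_le[of e "A e"] M(1)[of e] orthonormal_norm[OF orthonormal that]
    by (simp add: b_def)
  obtain G where G: "\<And>x. x \<ge> 0 \<Longrightarrow> cmod (g x) \<le> G"
    using assms(5) by (auto simp: bounded_iff g_def)
  have g_loc: "g absolutely_integrable_on {0..c}" for c
    using absolutely_integrable_linear[OF assms(6) bounded_linear_of_real, of c] by (simp add: g_def[abs_def] o_def)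
  obtain G' where G': "\<And>x. x \<ge> 0 \<Longrightarrow> cmod (f\<^sub>A x) \<le> G'"
    using assms(10) by (auto simp: bounded_iff)
  have Theta_eq: "op_trace (heat_op V D t) = Theta (\<lambda>_. 1) t"
      "op_trace (heat_op V D t \<circ> A) = Theta b t" if "t > 0" for t
  proof -
    have s: "(\<lambda>e. cmod (of_real (exp (- t * (lam e)\<^sup>2)))) summable_on E"
      using theta_summable[OF that] by simp
    show "op_trace (heat_op V D t) = Theta (\<lambda>_. 1) t"
      unfolding heat_op_def Theta_def
      using op_trace_fun_calc[where g = "\<lambda>l. of_real (exp (- t * l\<^sup>2))", OF s] by simp
    show "op_trace (heat_op V D t \<circ> A) = Theta b t"
      unfolding heat_op_def Theta_def b_def
      by (rule op_trace_fun_calc_comp[where g = "\<lambda>l. of_real (exp (- t * l\<^sup>2))", OF assms(9) s])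
  qed
  have ev_pos: "\<forall>\<^sub>F t in at_right 0. (t::real) > 0"
    by (rule eventually_at_right_less)
  \<comment> \<open>The traces are identified with the series for \<open>t > 0\<close>, which
    suffices because little-o at \<open>at_right 0\<close> depends on eventual values only.\<close>
  have asymp: "(\<lambda>t. Theta (\<lambda>_. 1) t - g (- ln t) * of_real (t powr - a))
      \<in> o[at_right 0](\<lambda>t. g (- ln t) * of_real (t powr - a))"
    using assms(8) unfolding \<alpha> g_def of_real_mult
    by (rule landau_o.small.in_cong[THEN iffD1, rotated])
       (use ev_pos in eventually_elim, simp add: Theta_eq)
  have asymp_A: "(\<lambda>t. Theta b t - f\<^sub>A (- ln t) * of_real (t powr - a))
      \<in> o[at_right 0](\<lambda>t. f\<^sub>A (- ln t) * of_real (t powr - a))"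
    using assms(14) unfolding \<alpha>
    by (rule landau_o.small.in_cong[THEN iffD1, rotated])
       (use ev_pos in eventually_elim, simp add: Theta_eq)
  obtain C where C: "C \<ge> 0"
    "\<And>t. t > 0 \<Longrightarrow> theta t \<le> C * (t powr (- a) * exp (- (\<delta>\<^sup>2 / 2) * t))"
    using theta_upper_bound[OF a G asymp] by metis
  obtain c where c: "c \<noteq> 0" "((\<lambda>s. s * laplace f s) \<longlongrightarrow> c) (at_right 0)"
    using assms(7) by blast
  have lap_g: "((\<lambda>s. s *\<^sub>R laplace g s) \<longlongrightarrow> of_real c) (at_right 0)"
    using tendsto_of_real[OF c(2), where ?'a = complex]
    unfolding g_def[abs_def] laplace_of_real by (simp add: scaleR_conv_of_real)
  obtain c' where "((\<lambda>s. of_real s * laplace f\<^sub>A s) \<longlongrightarrow> c') (at_right 0)"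
    using assms(13) by blast
  then have lap_A: "((\<lambda>s. s *\<^sub>R laplace f\<^sub>A s) \<longlongrightarrow> c') (at_right 0)"
    by (simp add: scaleR_conv_of_real)

  \<comment> \<open>The metric dimension\<close>
  have trace_class_iff: "trace_class (abs_neg_power V D s) \<longleftrightarrow>
      (\<lambda>e. ((lam e)\<^sup>2) powr - (s / 2)) summable_on E" for s
  proof -
    have "trace_class (abs_neg_power V D s) \<longleftrightarrow> (\<lambda>e. \<bar>lam e\<bar> powr - s) summable_on E"
      unfolding abs_neg_power_def
      using trace_class_fun_calcI[of "\<lambda>l. \<bar>l\<bar> powr - s"] trace_class_fun_calcD[of "\<lambda>l. \<bar>l\<bar> powr - s"] lam_nz
      by auto
    then show ?thesis
      by (simp only: square_powr_half)
  qed
  have summable: "(\<lambda>e. ((lam e)\<^sup>2) powr - z) summable_on E" if "z > a" for z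
    by (rule dirichlet_summable[OF a C(2) that])
  have not_trace_class: "\<not> trace_class (abs_neg_power V D s)" if "s < 2 * a" for s
  proof
    assume "trace_class (abs_neg_power V D s)"
    then have s: "(\<lambda>e. ((lam e)\<^sup>2) powr - (s / 2)) summable_on E"
      by (simp only: trace_class_iff)
    \<comment> \<open>\<open>not_summable_below\<close> asks for a positive exponent, while
      \<open>s\<close> is arbitrary below \<open>2 * a\<close>; the gap allows raising
      \<open>s / 2\<close> to \<open>z\<close> at the cost of the constant
      \<open>(\<delta>\<^sup>2) powr (s / 2 - z)\<close>.\<close>
    define z where "z = max (s / 2) (a / 2)"
    have z: "0 < z" "z < a" "s / 2 \<le> z"
      using a that by (auto simp: z_def)
    have "(\<lambda>e. ((lam e)\<^sup>2) powr - z) summable_on E"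
    proof (rule summable_on_comparison_test)
      show "(\<lambda>e. (\<delta>\<^sup>2) powr (s / 2 - z) * ((lam e)\<^sup>2) powr - (s / 2)) summable_on E"
        using s by (rule summable_on_cmult_right)
      show "((lam e)\<^sup>2) powr - z \<le> (\<delta>\<^sup>2) powr (s / 2 - z) * ((lam e)\<^sup>2) powr - (s / 2)" if "e \<in> E" for e
      proof -
        have "((lam e)\<^sup>2) powr - z = ((lam e)\<^sup>2) powr (s / 2 - z) * ((lam e)\<^sup>2) powr - (s / 2)"
          by (simp add: powr_add[symmetric])
        also have "((lam e)\<^sup>2) powr (s / 2 - z) \<le> (\<delta>\<^sup>2) powr (s / 2 - z)"
          using z(3) gap that by (intro powr_mono2') auto
        finally show ?thesis
          by (simp add: mult_right_mono)
      qed
    qed simp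
    moreover have "\<not> ((\<lambda>\<epsilon>. \<epsilon> *\<^sub>R laplace g \<epsilon>) \<longlongrightarrow> 0) (at_right 0)"
      using tendsto_unique[OF _ lap_g] c(1) by force
    ultimately show False
      using not_summable_below[OF z(1,2) G g_loc asymp] by blast
  qed
  have dim: "metric_dimension V D = 2 * a"
    unfolding metric_dimension_def
  proof (rule cInf_eq_non_empty)
    show "{s. trace_class (abs_neg_power V D s)} \<noteq> {}"
      using summable[of "(2 * a + 2) / 2"] trace_class_iff[of "2 * a + 2"] a by auto
    show "2 * a \<le> s" if "s \<in> {s. trace_class (abs_neg_power V D s)}" for s
      using not_trace_class[of s] that by fastforce
    show "y \<le> 2 * a" if "\<And>s. s \<in> {s. trace_class (abs_neg_power V D s)} \<Longrightarrow> y \<le> s" for y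
    \<comment> \<open>Whether \<open>2 * a\<close> itself lies in the set is left open, but every
      \<open>s > 2 * a\<close> does.\<close>
    proof (rule dense_ge)
      show "y \<le> s" if "2 * a < s" for s
        using that \<open>\<And>s. _ \<Longrightarrow> y \<le> s\<close>[of s] summable[of "s / 2"] by (simp add: trace_class_iff)
    qed
  qed

  \<comment> \<open>The limit of the quotient of traces\<close>
  have Zeta_eq: "spectral_zeta V D s = Zeta (\<lambda>_. 1) (s / 2)"
      "op_trace (abs_neg_power V D s \<circ> A) = Zeta b (s / 2)" if "s > 2 * a" for s
  proof -
    have s: "(\<lambda>e. cmod (of_real (\<bar>lam e\<bar> powr - s))) summable_on E"
      using summable[of "s / 2"] that by (simp add: square_powr_half)
    show "spectral_zeta V D s = Zeta (\<lambda>_. 1) (s / 2)"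
      unfolding spectral_zeta_def abs_neg_power_def Zeta_def square_powr_half
      using op_trace_fun_calc[where g = "\<lambda>l. of_real (\<bar>l\<bar> powr - s)", OF s] by simp
    show "op_trace (abs_neg_power V D s \<circ> A) = Zeta b (s / 2)"
      unfolding abs_neg_power_def Zeta_def square_powr_half b_def
      by (rule op_trace_fun_calc_comp[where g = "\<lambda>l. of_real (\<bar>l\<bar> powr - s)", OF assms(9) s])
  qed
  \<comment> \<open>\<open>?P b\<close> and \<open>?P (\<lambda>_. 1)\<close> share the factors
    \<open>\<epsilon>\<close> and \<open>Gamma (\<epsilon> + a)\<close>, which cancel in the
    quotient; the limit \<open>c \<noteq> 0\<close> of the second permits dividing.\<close>
  let ?P = "\<lambda>b \<epsilon>. \<epsilon> *\<^sub>R (Gamma (\<epsilon> + a) *\<^sub>R Zeta b (\<epsilon> + a))"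
  have "((\<lambda>\<epsilon>. ?P (\<lambda>_. 1) \<epsilon> - \<epsilon> *\<^sub>R laplace g \<epsilon>) \<longlongrightarrow> 0) (at_right 0)"
    by (rule zeta_laplace_limit[OF a C, where M = 1 and G = G]) (use G g_loc asymp in auto)
  from tendsto_add[OF this lap_g] have P1: "(?P (\<lambda>_. 1) \<longlongrightarrow> of_real c) (at_right 0)"
    by simp
  have "((\<lambda>\<epsilon>. ?P b \<epsilon> - \<epsilon> *\<^sub>R laplace f\<^sub>A \<epsilon>) \<longlongrightarrow> 0) (at_right 0)"
    by (rule zeta_laplace_limit[OF a C, where M = M and G = G'])
       (use G' assms(12) asymp_A b M(2) in auto)
  from tendsto_add[OF this lap_A] have PA: "(?P b \<longlongrightarrow> c') (at_right 0)"
    by simp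
  have "((\<lambda>\<epsilon>. ?P b \<epsilon> / ?P (\<lambda>_. 1) \<epsilon>) \<longlongrightarrow> c' / of_real c) (at_right 0)"
    using c(1) by (intro tendsto_divide PA P1) simp
  moreover have "\<forall>\<^sub>F \<epsilon> in at_right 0. ?P b \<epsilon> / ?P (\<lambda>_. 1) \<epsilon> =
      op_trace (abs_neg_power V D (2 * \<epsilon> + 2 * a) \<circ> A) / spectral_zeta V D (2 * \<epsilon> + 2 * a)"
    using ev_pos
  proof eventually_elim
    case (elim \<epsilon>)
    then have "0 < Gamma (\<epsilon> + a)"
      using a by (intro Gamma_real_pos) simp
    then have "Gamma (\<epsilon> + a) \<noteq> 0"
      by simp
    with elim show ?case
      by (simp add: Zeta_eq scaleR_conv_of_real add_divide_distrib)
  qed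
  ultimately have lim: "((\<lambda>\<epsilon>. op_trace (abs_neg_power V D (2 * \<epsilon> + 2 * a) \<circ> A) /
      spectral_zeta V D (2 * \<epsilon> + 2 * a)) \<longlongrightarrow> c' / of_real c) (at_right 0)"
    by (rule Lim_transform_eventually)
  \<comment> \<open>Change of variable \<open>s = 2 * \<epsilon> + 2 * a\<close>, where the factor 2
    stems from the squared eigenvalues.\<close>
  have "filterlim (\<lambda>s. (s - 2 * a) / 2) (at_right 0) (at_right (2 * a))"
    unfolding filterlim_at
  proof
    show "\<forall>\<^sub>F s in at_right (2 * a). (s - 2 * a) / 2 \<in> {0<..} \<and> (s - 2 * a) / 2 \<noteq> 0"
      using eventually_at_right_less[of "2 * a"] by eventually_elim simp
    show "((\<lambda>s. (s - 2 * a) / 2) \<longlongrightarrow> 0) (at_right (2 * a))"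
      by (auto intro!: tendsto_eq_intros)
  qed
  note lim = filterlim_compose[OF lim this]
  have "2 * ((s - 2 * a) / 2) + 2 * a = s" for s
    by (simp add: field_simps)
  with lim have zeta_lim: "((\<lambda>s. op_trace (abs_neg_power V D s \<circ> A) / spectral_zeta V D s) \<longlongrightarrow> c' / of_real c)
      (at_right (metric_dimension V D))"
    by (simp only: dim)
  then have state: "spectral_state V D A = c' / of_real c"
    unfolding spectral_state_def by (intro tendsto_Lim) simp_all
  \<comment> \<open>Numerator and denominator are multiplied by \<open>s\<close>, which gives them
    the limits \<open>c'\<close> and \<open>c \<noteq> 0\<close>.\<close>
  have "((\<lambda>s. (s *\<^sub>R laplace f\<^sub>A s) / (s *\<^sub>R laplace g s)) \<longlongrightarrow> c' / of_real c) (at_right 0)"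
    using c(1) by (intro tendsto_divide lap_A lap_g) simp
  moreover have "\<forall>\<^sub>F s in at_right 0. (s *\<^sub>R laplace f\<^sub>A s) / (s *\<^sub>R laplace g s) =
      laplace f\<^sub>A s / of_real (laplace f s)"
    using ev_pos
    by eventually_elim (simp add: g_def[abs_def] laplace_of_real scaleR_conv_of_real)
  ultimately have "((\<lambda>s. laplace f\<^sub>A s / of_real (laplace f s)) \<longlongrightarrow> c' / of_real c) (at_right 0)"
    by (rule Lim_transform_eventually)
  with zeta_lim show ?thesis
    unfolding state by blast
qed

end
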